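(* Fix $\epsilon>0$, $\delta\in(0,\tfrac1e)$ and $B>0$. Let $A$ be an $(n\times d)$-matrix in which every row has $\ell_2$-norm at most $B$, and fix an integer $\nu\ge d$. Let $w$ be such that \[ w^2=\frac{B^2}{\epsilon\left(1-\frac{\epsilon}{2\ln(4/\delta)}\right)}\left(2\sqrt{2\nu\ln(4/\delta)}+2\ln(4/\delta)\right). \] Then, given that $\sigma_{\min}(A)\ge w$, the algorithm that samples a matrix from the inverse-Wishart distribution $\mathcal W_d^{-1}(A^{\top}A,\nu)$ is $(\epsilon,\delta)$-differentially private.
   Context: The Wishart distribution $\mathcal W_d(V,m)$ is the distribution of $\sum_{i=1}^m\mathbf g_i\mathbf g_i^{\top}$ with $\mathbf g_i$ i.i.d. $\mathcal N(\mathbf 0_d,V)$; the inverse-Wishart distribution $\mathcal W_d^{-1}(\Psi,\nu)$ is the distribution of a positive definite $X$ with $X^{-1}\sim\mathcal W_d(\Psi^{-1},\nu)$. $\sigma_{\min}(A)$ is the least singular value of $A$. Two $(n\times d)$-matrices are neighbors if they differ in exactly one row. A randomized algorithm defined on a class of inputs (here: $(n\times d)$-matrices with rows of $\ell_2$-norm at most $B$ and $\sigma_{\min}(A)\ge w$) is $(\epsilon,\delta)$-differentially private if for all neighboring inputs $A,A'$ in the class and every measurable set $S$ of outputs, $\Pr[\mathsf{ALG}(A)\in S]\le e^{\epsilon}\Pr[\mathsf{ALG}(A')\in S]+\delta$. *)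

theory Defs
  imports "HOL-Analysis.Analysis" "HOL-Probability.Probability"
begin

definition std_gauss :: "(real ^ 'd) measure" where
  "std_gauss = density lborel (\<lambda>x. ennreal (\<Prod>i\<in>UNIV. std_normal_density (x $ i)))"

definition gauss :: "real ^ 'd ^ 'd \<Rightarrow> (real ^ 'd) measure" where
  "gauss V = distr std_gauss borel (\<lambda>z. (SOME L :: real ^ 'd ^ 'd. L ** transpose L = V) *v z)"

definition outer :: "real ^ 'd \<Rightarrow> real ^ 'd ^ 'd" where
  "outer g = (\<chi> j k. g $ j * g $ k)"

definition wishart :: "real ^ 'd ^ 'd \<Rightarrow> nat \<Rightarrow> (real ^ 'd ^ 'd) measure" where
  "wishart V m = distr (PiM {..<m} (\<lambda>_. gauss V)) borel (\<lambda>g. \<Sum>i<m. outer (g i))"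

definition inv_wishart :: "real ^ 'd ^ 'd \<Rightarrow> nat \<Rightarrow> (real ^ 'd ^ 'd) measure" where
  "inv_wishart Psi nu = distr (wishart (matrix_inv Psi) nu) borel matrix_inv"

definition sigma_min :: "real ^ 'd ^ 'n \<Rightarrow> real" where
  "sigma_min A = sqrt (Min {lam. \<exists>v. v \<noteq> 0 \<and> (transpose A ** A) *v v = lam *s v})"

definition neighbors :: "'a ^ 'd ^ 'n \<Rightarrow> 'a ^ 'd ^ 'n \<Rightarrow> bool" where
  "neighbors A A' \<longleftrightarrow> card {i. A $ i \<noteq> A' $ i} = 1"

definition differentially_private ::
  "('x ^ 'd ^ 'n) set \<Rightarrow> ('x ^ 'd ^ 'n \<Rightarrow> 'b measure) \<Rightarrow> real \<Rightarrow> real \<Rightarrow> bool" where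
  "differentially_private C M eps del \<longleftrightarrow>
     (\<forall>A\<in>C. \<forall>A'\<in>C. neighbors A A' \<longrightarrow>
        (\<forall>S\<in>sets (M A). measure (M A) S \<le> exp eps * measure (M A') S + del))"

end

(* By post-processing it suffices to compare nu i.i.d. samples from N(0, M^-1) and N(0, M'^-1), where
   M = A^T A and M' = M - a a^T + a' a'^T.  A Chernoff bound on the likelihood ratio reduces this to
   the Renyi moment of order 1 + lam of one sample, a Gaussian integral whose value involves only
   det M, det M' and det N with N = M + lam (a a^T - a' a'^T).  These determinants differ by rank-one
   updates with factors 1 +- k s, where s = a^T M^-1 a and s' = a'^T M^-1 a' are at most B^2 / w^2.
   In the logarithm of the moment the terms linear in s and s' cancel, and the choice
   lam B^2 / w^2 = q / (1 + q) with q = sqrt (ln (4 / del) / nu) makes the rest fit the budget. *)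

theory Submission
  imports Defs
begin

text \<open>The determinant estimates never touch \<open>M\<close>, \<open>M'\<close> or
  \<open>N\<close> directly. Each form is carried by a square factor \<open>R\<close>: the form is
  \<open>(norm (R *v x))^2\<close>, the determinant is \<open>(det R)^2\<close>, and a rank-one
  change of the form becomes a left multiplication of \<open>R\<close> by 1 + k b b^T. If
  \<open>b v* R = a\<close> with \<open>R\<close> invertible, then \<open>(norm b)^2\<close> is a^T
  M^-1 a, so the quantities s and s' are squared norms of vectors. Two obstacles shape the rest.
  Going from \<open>M\<close> to \<open>M'\<close> or \<open>N\<close> subtracts a square, which
  could destroy positive definiteness; with t = B^2 / w^2, the conditions t < 1 and lam t < 1
  prevent this. And \<open>gauss\<close> takes its factor of the covariance by \<open>SOME\<close>,
  so its law has to be shown to depend on the covariance alone before any density can be written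
  down.\<close>

section \<open>Rank-one updates and dual norms\<close>

lemma rank_one_mult: "(mat 1 + c *\<^sub>R outer b) *v y = y + (c * (b \<bullet> y)) *\<^sub>R b"
  for b y :: "real^'d"
proof -
  have "outer b *v y = (b \<bullet> y) *\<^sub>R b"
    by (simp add: vec_eq_iff matrix_vector_mult_def outer_def inner_vec_def
        sum_distrib_left sum_distrib_right mult_ac)
  then show ?thesis
    by (simp add: matrix_vector_mult_add_rdistrib flip: scaleR_matrix_vector_assoc)
qed

text \<open>The matrix determinant lemma in its symmetric case. An orthogonal \<open>Q\<close>
  taking a coordinate axis (any index \<open>k\<close> will do) to the direction of \<open>b\<close>
  conjugates the update to the diagonal matrix \<open>D\<close>.\<close>

lemma det_rank_one_update: "det (mat 1 + c *\<^sub>R outer b) = 1 + c * (norm b)\<^sup>2"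
  for b :: "real^'d"
proof (cases "b = 0")
  case True
  then have "outer b = 0" by (simp add: vec_eq_iff outer_def)
  with True show ?thesis by simp
next
  case False
  obtain k :: 'd where True by simp
  obtain Q :: "real^'d^'d" where Q: "orthogonal_matrix Q" "Q *v axis k 1 = b /\<^sub>R norm b"
    using orthogonal_matrix_exists_basis[of "b /\<^sub>R norm b" k] False by auto
  define D where "D = mat 1 + (c * (norm b)\<^sup>2) *\<^sub>R outer (axis k 1 :: real^'d)"
  have QQ: "Q ** transpose Q = mat 1" "transpose Q ** Q = mat 1"
    using Q(1) by (auto simp: orthogonal_matrix_def)
  have b: "b = norm b *\<^sub>R (Q *v axis k 1)" using Q(2) False by simp
  have "(mat 1 + c *\<^sub>R outer b) ** Q = Q ** D"
  proof (subst matrix_eq, rule allI)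
    fix x
    have i: "(Q *v axis k 1) \<bullet> (Q *v x) = axis k 1 \<bullet> x"
      using QQ(2) by (metis dot_lmul_matrix matrix_vector_mul_assoc matrix_vector_mul_lid transpose_matrix_vector)
    have "((mat 1 + c *\<^sub>R outer b) ** Q) *v x = Q *v x + (c * (b \<bullet> (Q *v x))) *\<^sub>R b"
      by (simp add: rank_one_mult flip: matrix_vector_mul_assoc)
    also have "b \<bullet> (Q *v x) = norm b * (axis k 1 \<bullet> x)"
      by (subst b) (simp add: i)
    also have "(c * (norm b * (axis k 1 \<bullet> x))) *\<^sub>R b
        = (c * (norm b)\<^sup>2 * (axis k 1 \<bullet> x)) *\<^sub>R (Q *v axis k 1)"
      by (subst (2) b) (simp add: power2_eq_square algebra_simps)
    also have "Q *v x + \<dots> = (Q ** D) *v x"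
      by (simp add: D_def rank_one_mult matrix_vector_right_distrib matrix_vector_mult_scaleR
          flip: matrix_vector_mul_assoc)
    finally show "((mat 1 + c *\<^sub>R outer b) ** Q) *v x = (Q ** D) *v x" .
  qed
  then have "det (mat 1 + c *\<^sub>R outer b) * det Q = det Q * det D" by (metis det_mul)
  moreover have "det Q \<noteq> 0" using QQ by (metis det_I det_mul mult_eq_0_iff zero_neq_one)
  moreover have "det D = 1 + c * (norm b)\<^sup>2"
  proof -
    have "det D = (\<Prod>i\<in>UNIV. D $ i $ i)"
      by (rule det_diagonal) (auto simp: D_def mat_def outer_def axis_def)
    also have "\<dots> = (\<Prod>i\<in>UNIV. if i = k then 1 + c * (norm b)\<^sup>2 else 1)"
      by (intro prod.cong) (auto simp: D_def mat_def outer_def axis_def)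
    also have "\<dots> = 1 + c * (norm b)\<^sup>2" by simp
    finally show ?thesis .
  qed
  ultimately show ?thesis by simp
qed

lemma matrix_vector_surj:
  fixes R :: "real^'d^'d"
  assumes "det R \<noteq> 0"
  obtains x where "R *v x = b"
  using assms by (metis invertible_det_nz invertible_eq_bij bij_pointE)

text \<open>Since a = R^T b, the new form R^T R + c a a^T equals R^T (1 + c b b^T) R, and the middle
  factor has a real square root because of \<open>pos\<close>.\<close>

lemma rank_one_factor:
  fixes R :: "real^'d^'d"
  assumes b: "b v* R = a" and pos: "1 + c * (norm b)\<^sup>2 > 0"
  obtains R' :: "real^'d^'d" where "(det R')\<^sup>2 = (det R)\<^sup>2 * (1 + c * (norm b)\<^sup>2)"
    "\<And>x. (norm (R' *v x))\<^sup>2 = (norm (R *v x))\<^sup>2 + c * (a \<bullet> x)\<^sup>2"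
proof -
  \<comment> \<open>Chosen so that 1 + k b b^T squares to 1 + c b b^T.\<close>
  define k where "k = (if b = 0 then 0 else (sqrt (1 + c * (norm b)\<^sup>2) - 1) / (norm b)\<^sup>2)"
  have k: "(1 + k * (norm b)\<^sup>2)\<^sup>2 = 1 + c * (norm b)\<^sup>2"
    using pos by (auto simp: k_def)
  then have k': "(2 * k + k\<^sup>2 * (norm b)\<^sup>2) * (norm b)\<^sup>2 = c * (norm b)\<^sup>2"
    by (simp add: power2_eq_square algebra_simps)
  define R' where "R' = (mat 1 + k *\<^sub>R outer b) ** R"
  have "(det R')\<^sup>2 = (det R)\<^sup>2 * (1 + c * (norm b)\<^sup>2)"
    using k by (simp add: R'_def det_mul det_rank_one_update power_mult_distrib)
  moreover have "(norm (R' *v x))\<^sup>2 = (norm (R *v x))\<^sup>2 + c * (a \<bullet> x)\<^sup>2" for x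
  proof -
    define y where "y = R *v x"
    have "R' *v x = y + (k * (b \<bullet> y)) *\<^sub>R b"
      by (simp add: R'_def y_def rank_one_mult flip: matrix_vector_mul_assoc)
    then have "(norm (R' *v x))\<^sup>2 = (norm y)\<^sup>2 + (2 * k + k\<^sup>2 * (norm b)\<^sup>2) * (b \<bullet> y)\<^sup>2"
      unfolding power2_norm_eq_inner
      by (simp add: inner_add inner_commute power2_eq_square algebra_simps)
    also have "(2 * k + k\<^sup>2 * (norm b)\<^sup>2) * (b \<bullet> y)\<^sup>2 = c * (b \<bullet> y)\<^sup>2"
      using k' by (cases "b = 0") auto
    also have "b \<bullet> y = a \<bullet> x" by (simp add: y_def dot_lmul_matrix flip: b)
    finally show ?thesis by (simp add: y_def)
  qed
  ultimately show ?thesis using that by blast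
qed

text \<open>For invertible \<open>R\<close>, \<open>norm b\<close> is the norm dual to
  \<open>norm (R *v x)\<close>, evaluated at \<open>a\<close>; duality reverses the order. The
  Cauchy-Schwarz test vector is the \<open>x\<close> with \<open>S *v x = c\<close>.\<close>

lemma dual_norm_antimono:
  fixes R S :: "real^'d^'d"
  assumes "b v* R = a" "c v* S = a" "det S \<noteq> 0"
    and le: "\<And>x. (norm (R *v x))\<^sup>2 \<le> (norm (S *v x))\<^sup>2"
  shows "norm c \<le> norm b"
proof -
  obtain x where x: "S *v x = c" using assms(3) by (rule matrix_vector_surj)
  have "(norm c)\<^sup>2 = a \<bullet> x"
    using x by (simp add: power2_norm_eq_inner dot_lmul_matrix flip: assms(2))
  also have "\<dots> = b \<bullet> (R *v x)" by (simp add: dot_lmul_matrix flip: assms(1))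
  also have "\<dots> \<le> norm b * norm (R *v x)" by (rule norm_cauchy_schwarz)
  also have "\<dots> \<le> norm b * norm c"
    using le[of x] x by (intro mult_left_mono) auto
  finally show ?thesis
    by (cases "c = 0") (auto simp: power2_eq_square)
qed

text \<open>Turns the radius \<open>B\<close> of the rows and the lower bound \<open>w\<close> into
  the sensitivity B^2 / w^2, which is all that the later estimates know about the input.\<close>

lemma dual_norm_bound:
  fixes R :: "real^'d^'d"
  assumes "b v* R = a" "det R \<noteq> 0" "w > 0" "norm a \<le> B"
    and lower: "\<And>x. w * norm x \<le> norm (R *v x)"
  shows "(norm b)\<^sup>2 \<le> B\<^sup>2 / w\<^sup>2"
proof -
  obtain x where x: "R *v x = b" using assms(2) by (rule matrix_vector_surj)
  have "(norm b)\<^sup>2 = a \<bullet> x"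
    using x by (simp add: power2_norm_eq_inner dot_lmul_matrix flip: assms(1))
  also have "\<dots> \<le> norm a * norm x" by (rule norm_cauchy_schwarz)
  also have "\<dots> \<le> B * (norm b / w)"
    using lower[of x] x assms(3,4) order_trans[OF norm_ge_zero assms(4)]
    by (intro mult_mono) (auto simp: field_simps)
  finally have "norm b \<le> B / w"
    using assms(3) order_trans[OF norm_ge_zero assms(4)]
    by (cases "b = 0") (auto simp: power2_eq_square field_simps)
  then show ?thesis by (metis norm_ge_zero power_divide power_mono)
qed

section \<open>Least singular value and square factors\<close>

text \<open>A first-order condition at a minimum without derivatives: near 0 the linear term
  dominates, and \<open>h = - b / k\<close> with \<open>k = 1 + \<bar>c\<bar>\<close> is already
  small enough to make the sum negative.\<close>

lemma quadratic_nonneg_imp_linear_zero: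
  fixes b c :: real
  assumes "\<And>h. 0 \<le> 2 * h * b + h\<^sup>2 * c"
  shows "b = 0"
proof (rule ccontr)
  assume b: "b \<noteq> 0"
  define k where "k = 1 + \<bar>c\<bar>"
  have k: "k > 0" "c < k" by (auto simp: k_def)
  have "0 \<le> 2 * (-b / k) * b + (-b / k)\<^sup>2 * c" by (rule assms)
  also have "\<dots> = b\<^sup>2 * (c / k - 2) / k"
    using k by (simp add: field_simps power2_eq_square)
  also have "\<dots> < 0"
  proof -
    have "c / k < 1" using k by (simp add: field_simps)
    then have "c / k - 2 < 0" by linarith
    then show ?thesis using b k by (intro divide_neg_pos mult_pos_neg) auto
  qed
  finally show False by simp
qed

lemma inner_gram: "x \<bullet> ((transpose A ** A) *v y) = (A *v x) \<bullet> (A *v (y :: real^'d))"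
  for A :: "real^'d^'n"
  by (metis dot_lmul_matrix inner_commute matrix_vector_mul_assoc transpose_matrix_vector)

text \<open>Without finiteness the \<open>Min\<close> in \<open>sigma_min\<close> would say nothing.
  Eigenvectors for distinct eigenvalues of a symmetric matrix are orthogonal, hence
  independent.\<close>

lemma finite_gram_eigenvalues:
  fixes A :: "real^'d^'n"
  shows "finite {lam. \<exists>v. v \<noteq> 0 \<and> (transpose A ** A) *v v = lam *s v}" (is "finite ?E")
proof -
  let ?M = "transpose A ** A"
  define f where "f lam = (SOME v. v \<noteq> 0 \<and> ?M *v v = lam *s v)" for lam
  have f: "f lam \<noteq> 0" "?M *v f lam = lam *s f lam" if "lam \<in> ?E" for lam
    using someI_ex[of "\<lambda>v. v \<noteq> 0 \<and> ?M *v v = lam *s v"] that unfolding f_def by auto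
  have orth: "f l \<bullet> f m = 0" if "l \<in> ?E" "m \<in> ?E" "l \<noteq> m" for l m
  proof -
    have "f l \<bullet> (?M *v f m) = f m \<bullet> (?M *v f l)"
      by (simp add: inner_gram inner_commute)
    then have "m * (f l \<bullet> f m) = l * (f l \<bullet> f m)"
      using f that by (simp add: scalar_mult_eq_scaleR inner_commute)
    then show ?thesis using that by simp
  qed
  have inj: "inj_on f ?E"
    by (intro inj_onI) (metis (no_types, lifting) f(1) inner_eq_zero_iff orth)
  have "independent (f ` ?E)"
  proof (rule pairwise_orthogonal_independent)
    show "pairwise orthogonal (f ` ?E)"
      using orth by (force simp: pairwise_def orthogonal_def)
    show "0 \<notin> f ` ?E" using f(1) by (metis (no_types, lifting) imageE)
  qed
  then have "finite (f ` ?E)" by (rule independent_imp_finite)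
  then show ?thesis using inj by (simp add: finite_image_iff)
qed

text \<open>By compactness the Rayleigh quotient attains a minimum \<open>l\<close> on the unit
  sphere. As \<open>l\<close> is an eigenvalue of the Gram matrix, it is at least the smallest
  one.\<close>

lemma norm_ge_sigma_min:
  fixes A :: "real^'d^'n"
  assumes w: "w > 0" "sigma_min A \<ge> w"
  shows "w * norm x \<le> norm (A *v x)"
proof -
  let ?M = "transpose A ** A"
  let ?f = "\<lambda>x. (norm (A *v x))\<^sup>2"
  have "compact (sphere (0::real^'d) 1)" "sphere (0::real^'d) 1 \<noteq> {}"
    by (auto simp: sphere_eq_empty)
  moreover have "continuous_on (sphere (0::real^'d) 1) ?f"
    by (intro continuous_intros linear_continuous_on)
  ultimately obtain v where v: "norm v = 1" "\<And>y. norm y = 1 \<Longrightarrow> ?f v \<le> ?f y"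
    using continuous_attains_inf[of "sphere (0::real^'d) 1" ?f] by (auto simp: dist_norm)
  define l where "l = ?f v"
  have lb: "l * (norm y)\<^sup>2 \<le> ?f y" for y
  proof (cases "y = 0")
    case False
    have "l \<le> ?f (y /\<^sub>R norm y)" unfolding l_def using False by (intro v(2)) simp
    also have "\<dots> = ?f y / (norm y)\<^sup>2"
      by (simp add: matrix_vector_mult_scaleR field_simps power2_eq_square)
    finally show ?thesis using False by (simp add: field_simps)
  qed simp
  \<comment> \<open>the minimiser of the Rayleigh quotient is an eigenvector\<close>
  define u where "u = ?M *v v - l *s v"
  have "u \<bullet> u = 0"
  \<comment> \<open>Perturbing \<open>v\<close> along the residual \<open>u\<close> itself makes the
    linear coefficient equal to \<open>u \<bullet> u\<close>.\<close>
  proof (rule quadratic_nonneg_imp_linear_zero)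
    fix h :: real
    have "0 \<le> ?f (v + h *\<^sub>R u) - l * (norm (v + h *\<^sub>R u))\<^sup>2" using lb by simp
    also have "\<dots> = 2 * h * ((A *v v) \<bullet> (A *v u) - l * (v \<bullet> u)) + h\<^sup>2 * (?f u - l * (norm u)\<^sup>2)"
    proof -
      have "?f (v + h *\<^sub>R u) = l + 2 * h * ((A *v v) \<bullet> (A *v u)) + h\<^sup>2 * ?f u"
        unfolding l_def power2_norm_eq_inner
        by (simp add: matrix_vector_right_distrib matrix_vector_mult_scaleR inner_add inner_commute
            power2_eq_square algebra_simps)
      moreover have "(norm (v + h *\<^sub>R u))\<^sup>2 = 1 + 2 * h * (v \<bullet> u) + h\<^sup>2 * (norm u)\<^sup>2"
        using v(1) unfolding power2_norm_eq_inner norm_eq_1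
        by (simp add: inner_add inner_commute power2_eq_square algebra_simps)
      ultimately show ?thesis by (simp add: algebra_simps)
    qed
    also have "(A *v v) \<bullet> (A *v u) - l * (v \<bullet> u) = u \<bullet> u"
      by (simp add: u_def inner_simps flip: inner_gram)
         (simp add: inner_gram inner_commute inner_simps scalar_mult_eq_scaleR algebra_simps)
    finally show "0 \<le> 2 * h * (u \<bullet> u) + h\<^sup>2 * (?f u - l * (norm u)\<^sup>2)" .
  qed
  then have "?M *v v = l *s v" by (simp add: u_def)
  then have "l \<in> {lam. \<exists>v. v \<noteq> 0 \<and> ?M *v v = lam *s v}" using v(1) by (intro CollectI exI[of _ v]) auto
  then have "Min {lam. \<exists>v. v \<noteq> 0 \<and> ?M *v v = lam *s v} \<le> l"
    by (intro Min_le finite_gram_eigenvalues)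
  then have "sigma_min A \<le> sqrt l" by (simp add: sigma_min_def)
  then have "w \<le> sqrt l" using w by simp
  then have "w\<^sup>2 \<le> l" using w by (simp add: real_le_rsqrt real_le_lsqrt sqrt_ge_absD)
  then have "w\<^sup>2 * (norm x)\<^sup>2 \<le> ?f x" using lb[of x] by (meson mult_right_mono order_trans zero_le_power2)
  then have "(w * norm x)\<^sup>2 \<le> (norm (A *v x))\<^sup>2" by (simp add: power_mult_distrib)
  then show ?thesis by (rule power2_le_imp_le) simp
qed

text \<open>The range of \<open>A\<close> has dimension at most that of the domain, so it embeds
  isometrically there. Composing \<open>A\<close> with this isometry keeps the form and yields a
  matrix that has a determinant.\<close>

lemma square_factor_exists:
  fixes A :: "real^'d^'n"
  assumes inj: "\<And>x. A *v x = 0 \<Longrightarrow> x = 0"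
  obtains R :: "real^'d^'d" where "det R \<noteq> 0" "\<And>x. norm (R *v x) = norm (A *v x)"
proof -
  have "dim (range ((*v) A)) \<le> dim (UNIV :: (real^'d) set)"
    by (intro dim_image_le) simp
  then obtain f :: "real^'n \<Rightarrow> real^'d" where f: "linear f" "\<And>x. x \<in> range ((*v) A) \<Longrightarrow> norm (f x) = norm x"
    using isometry_subset_subspace[of "range ((*v) A)" "UNIV :: (real^'d) set"]
    by (metis linear_subspace_image matrix_vector_mul_linear subspace_UNIV)
  define R where "R = matrix f ** A"
  have R: "R *v x = f (A *v x)" for x
    using f(1) by (simp add: R_def flip: matrix_vector_mul_assoc)
  have n: "norm (R *v x) = norm (A *v x)" for x by (simp add: R f(2))
  have "R *v x = 0 \<Longrightarrow> x = 0" for x using n[of x] inj[of x] by auto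
  then have "det R \<noteq> 0"
    by (metis invertible_det_nz invertible_left_inverse matrix_left_invertible_ker)
  then show ?thesis using n that by blast
qed

section \<open>Gaussian densities\<close>

text \<open>For invertible \<open>R\<close>, the density of the centred Gaussian law with precision
  matrix R^T R. Parametrising by a factor of the precision avoids an inverse in the
  exponent.\<close>

definition gaussian_density :: "real^'d^'d \<Rightarrow> real^'d \<Rightarrow> real" where
  "gaussian_density R x = (1 / sqrt (2 * pi)) ^ CARD('d) * \<bar>det R\<bar> * exp (- (norm (R *v x))\<^sup>2 / 2)"

lemma measurable_matrix_vector_mult [measurable]: "(*v) (A :: real^'d^'n) \<in> borel \<rightarrow>\<^sub>M borel"
  by (intro borel_measurable_continuous_onI linear_continuous_on) simp

lemma measurable_gaussian_density [measurable]: "gaussian_density R \<in> borel_measurable borel"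
  unfolding gaussian_density_def by measurable

lemma gaussian_density_nonneg: "gaussian_density R x \<ge> 0"
  by (simp add: gaussian_density_def)

lemma gaussian_density_pos: "det R \<noteq> 0 \<Longrightarrow> gaussian_density R x > 0"
  by (simp add: gaussian_density_def)

lemma std_normal_prod: "(\<Prod>i\<in>UNIV. std_normal_density (x $ i)) = gaussian_density (mat 1) x"
  for x :: "real^'d"
proof -
  have "(\<Prod>i\<in>UNIV. std_normal_density (x $ i))
      = (1 / sqrt (2 * pi)) ^ CARD('d) * exp (\<Sum>i\<in>UNIV. - (x $ i)\<^sup>2 / 2)"
    by (simp add: std_normal_density_def prod.distrib exp_sum prod_dividef power_one_over)
  also have "(\<Sum>i\<in>UNIV. - (x $ i)\<^sup>2 / 2) = - (norm x)\<^sup>2 / 2"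
    unfolding power2_norm_eq_inner
    by (simp add: inner_vec_def power2_eq_square sum_negf flip: sum_divide_distrib)
  finally show ?thesis by (simp add: gaussian_density_def)
qed

lemma std_gauss_eq: "std_gauss = density lborel (gaussian_density (mat 1))"
  unfolding std_gauss_def std_normal_prod ..

lemma nn_integral_std_normal_density: "(\<integral>\<^sup>+x. ennreal (std_normal_density x) \<partial>lborel) = 1"
proof -
  interpret prob_space "density lborel std_normal_density"
    by (rule prob_space_normal_density) simp
  show ?thesis using emeasure_space_1 by (simp add: emeasure_density)
qed

lemma prob_space_std_gauss: "prob_space (std_gauss :: (real^'d) measure)"
proof
  have "emeasure (std_gauss :: (real^'d) measure) (space std_gauss)
     = (\<integral>\<^sup>+x. (\<Prod>i\<in>UNIV. ennreal (std_normal_density ((x :: real^'d) $ i))) \<partial>lborel)"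
    unfolding std_gauss_def by (simp add: emeasure_density prod_ennreal)
  also have "\<dots> = (\<integral>\<^sup>+x. (\<Prod>b\<in>Basis. ennreal (std_normal_density ((x :: real^'d) \<bullet> b))) \<partial>lborel)"
    by (intro nn_integral_cong)
       (simp add: Basis_vec_def UNION_singleton_eq_range prod.reindex inj_on_def axis_eq_axis inner_axis)
  also have "\<dots> = 1"
    by (subst nn_integral_lborel_prod) (auto simp: nn_integral_std_normal_density)
  finally show "emeasure (std_gauss :: (real^'d) measure) (space std_gauss) = 1" .
qed

section \<open>Linear change of variables for Lebesgue measure\<close>

text \<open>With coordinate \<open>m\<close> integrated innermost, the shear is a translation by a
  constant: \<open>m \<noteq> n\<close> keeps coordinate \<open>n\<close> fixed in the inner
  integral.\<close>

lemma nn_integral_lborel_shear: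
  fixes h :: "real^'d \<Rightarrow> ennreal"
  assumes [measurable]: "h \<in> borel_measurable borel" and "m \<noteq> n"
  shows "(\<integral>\<^sup>+x. h (x + (c * x $ n) *\<^sub>R axis m 1) \<partial>lborel) = (\<integral>\<^sup>+x. h x \<partial>lborel)"
proof -
  let ?e = "axis m 1 :: real^'d"
  define I where "I = (Basis :: (real^'d) set) - {?e}"
  have e: "?e \<in> Basis" by (simp add: axis_in_Basis_iff)
  have I: "finite I" "?e \<notin> I" "Basis = insert ?e I" using e by (auto simp: I_def)
  interpret P: product_sigma_finite "\<lambda>_ :: real^'d. lborel :: real measure" ..
  define v where "v x = (\<Sum>b\<in>I. x b *\<^sub>R b)" for x :: "real^'d \<Rightarrow> real"
  have v: "(\<Sum>b\<in>Basis. (x(?e := y)) b *\<^sub>R b) = y *\<^sub>R ?e + v x" for x y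
  proof -
    have "(\<Sum>b\<in>I. (x(?e := y)) b *\<^sub>R b) = v x"
      unfolding v_def using I(2) by (intro sum.cong) auto
    then show ?thesis unfolding I(3) using I(1,2) by simp
  qed
  have fubini: "(\<integral>\<^sup>+x. f x \<partial>lborel)
      = (\<integral>\<^sup>+x. (\<integral>\<^sup>+y. f (y *\<^sub>R ?e + v x) \<partial>lborel) \<partial>PiM I (\<lambda>_. lborel))"
    if [measurable]: "f \<in> borel_measurable borel" for f :: "real^'d \<Rightarrow> ennreal"
  proof -
    have "(\<integral>\<^sup>+x. f x \<partial>lborel)
        = (\<integral>\<^sup>+x. f (\<Sum>b\<in>Basis. x b *\<^sub>R b) \<partial>PiM Basis (\<lambda>_. lborel))"
      by (subst lborel_eq) (simp add: nn_integral_distr)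
    also have "\<dots> = (\<integral>\<^sup>+x. (\<integral>\<^sup>+y. f (\<Sum>b\<in>Basis. (x(?e := y)) b *\<^sub>R b) \<partial>lborel) \<partial>PiM I (\<lambda>_. lborel))"
      unfolding I(3) by (subst P.product_nn_integral_insert[OF I(1,2)]) auto
    finally show ?thesis unfolding v .
  qed
  have [measurable]: "(\<lambda>x :: real^'d. x $ n) \<in> borel_measurable borel"
    by (intro borel_measurable_continuous_onI continuous_intros)
  have "(\<integral>\<^sup>+x. h (x + (c * x $ n) *\<^sub>R ?e) \<partial>lborel)
      = (\<integral>\<^sup>+x. (\<integral>\<^sup>+y. h (y *\<^sub>R ?e + v x + (c * (y *\<^sub>R ?e + v x) $ n) *\<^sub>R ?e) \<partial>lborel) \<partial>PiM I (\<lambda>_. lborel))"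
    by (subst fubini) auto
  also have "\<dots> = (\<integral>\<^sup>+x. (\<integral>\<^sup>+y. h (y *\<^sub>R ?e + v x) \<partial>lborel) \<partial>PiM I (\<lambda>_. lborel))"
  proof (rule nn_integral_cong)
    fix x
    have "(\<integral>\<^sup>+y. h (y *\<^sub>R ?e + v x) \<partial>lborel) = (\<integral>\<^sup>+y. h ((c * v x $ n + 1 * y) *\<^sub>R ?e + v x) \<partial>lborel)"
      by (subst nn_integral_real_affine[where c = 1 and t = "c * v x $ n"]) auto
    also have "\<dots> = (\<integral>\<^sup>+y. h (y *\<^sub>R ?e + v x + (c * (y *\<^sub>R ?e + v x) $ n) *\<^sub>R ?e) \<partial>lborel)"
      using assms(2) by (intro nn_integral_cong arg_cong[of _ _ h]) (simp add: axis_def algebra_simps)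
    finally show "(\<integral>\<^sup>+y. h (y *\<^sub>R ?e + v x + (c * (y *\<^sub>R ?e + v x) $ n) *\<^sub>R ?e) \<partial>lborel)
        = (\<integral>\<^sup>+y. h (y *\<^sub>R ?e + v x) \<partial>lborel)" by simp
  qed
  also have "\<dots> = (\<integral>\<^sup>+x. h x \<partial>lborel)" by (rule fubini[symmetric]) measurable
  finally show ?thesis .
qed

lemma prod_Basis_vec: "(\<Prod>b\<in>Basis. f b) = (\<Prod>i\<in>UNIV. f (axis i 1))" for f :: "real^'d \<Rightarrow> real"
  by (simp add: Basis_vec_def UNION_singleton_eq_range prod.reindex inj_on_def axis_eq_axis)

text \<open>Lebesgue measure is determined by the volumes of boxes. For an involution, the preimage
  of a box is the box with permuted corners, and a product of side lengths ignores their
  order.\<close>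

lemma lborel_permute_coordinates:
  fixes p :: "'d::finite \<Rightarrow> 'd"
  assumes p: "\<And>i. p (p i) = i"
  shows "lborel = distr lborel borel (\<lambda>x :: real^'d. \<chi> i. x $ p i)"
proof (rule lborel_eqI)
  let ?f = "\<lambda>x :: real^'d. \<chi> i. x $ p i"
  have [measurable]: "?f \<in> borel \<rightarrow>\<^sub>M borel"
    by (intro borel_measurable_continuous_onI continuous_intros)
  fix l u :: "real^'d"
  assume lu: "\<And>b. b \<in> Basis \<Longrightarrow> l \<bullet> b \<le> u \<bullet> b"
  have lu': "l $ i \<le> u $ i" for i
    using lu[of "axis i 1"] by (simp add: axis_in_Basis_iff inner_axis)
  have "?f -` box l u = box (?f l) (?f u)"
    using p by (auto simp: mem_box_cart) metis+
  then have "emeasure (distr lborel borel ?f) (box l u) = emeasure lborel (box (?f l) (?f u))"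
    by (subst emeasure_distr) auto
  also have "\<dots> = ennreal (\<Prod>b\<in>Basis. (?f u - ?f l) \<bullet> b)"
    using lu' by (intro emeasure_lborel_box) (auto simp: Basis_vec_def inner_axis)
  also have "(\<Prod>b\<in>Basis. (?f u - ?f l) \<bullet> b) = (\<Prod>i\<in>UNIV. u $ p i - l $ p i)"
    by (simp add: prod_Basis_vec inner_axis)
  also have "\<dots> = (\<Prod>i\<in>UNIV. u $ i - l $ i)"
    by (rule prod.reindex_bij_betw) (metis p bij_betw_def inj_def surj_def)
  also have "\<dots> = (\<Prod>b\<in>Basis. (u - l) \<bullet> b)"
    by (simp add: prod_Basis_vec inner_axis)
  finally show "emeasure (distr lborel borel ?f) (box l u) = (\<Prod>b\<in>Basis. (u - l) \<bullet> b)" .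
qed simp

text \<open>The library has this only for wellordered index types, so it is rederived from elementary
  matrices.\<close>

lemma nn_integral_lborel_linear:
  fixes L :: "real^'d^'d"
  assumes "det L \<noteq> 0" and "h \<in> borel_measurable borel"
  shows "(\<integral>\<^sup>+x. h x \<partial>lborel) = ennreal \<bar>det L\<bar> * (\<integral>\<^sup>+x. h (L *v x) \<partial>lborel)"
proof -
  \<comment> \<open>Guarding by a nonzero determinant makes the zero-row generator vacuous, and it
    passes from a product to both of its factors.\<close>
  define P where "P L \<longleftrightarrow> (det L \<noteq> 0 \<longrightarrow> (\<forall>h\<in>borel_measurable borel.
    (\<integral>\<^sup>+x. h x \<partial>lborel) = ennreal \<bar>det L\<bar> * (\<integral>\<^sup>+x. h (L *v x) \<partial>lborel)))" for L :: "real^'d^'d"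
  have "P L"
  proof (rule induct_matrix_elementary)
    fix A B :: "real^'d^'d"
    assume A: "P A" and B: "P B"
    show "P (A ** B)"
      unfolding P_def
    proof (intro impI ballI)
      fix h :: "real^'d \<Rightarrow> ennreal"
      assume det: "det (A ** B) \<noteq> 0" and [measurable]: "h \<in> borel_measurable borel"
      from det have nz: "det A \<noteq> 0" "det B \<noteq> 0" by (auto simp: det_mul)
      have "(\<integral>\<^sup>+x. h x \<partial>lborel) = ennreal \<bar>det A\<bar> * (\<integral>\<^sup>+x. h (A *v x) \<partial>lborel)"
        using A nz(1) unfolding P_def by (elim impE bspec) auto
      also have "(\<integral>\<^sup>+x. h (A *v x) \<partial>lborel) = ennreal \<bar>det B\<bar> * (\<integral>\<^sup>+x. h (A *v (B *v x)) \<partial>lborel)"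
        using B nz(2) unfolding P_def by (elim impE bspec[where x = "\<lambda>x. h (A *v x)"]) auto
      finally show "(\<integral>\<^sup>+x. h x \<partial>lborel)
          = ennreal \<bar>det (A ** B)\<bar> * (\<integral>\<^sup>+x. h ((A ** B) *v x) \<partial>lborel)"
        by (simp add: det_mul abs_mult ennreal_mult matrix_vector_mul_assoc mult.assoc)
    qed
  next
    fix A :: "real^'d^'d" and i
    assume "row i A = 0"
    then show "P A" by (simp add: P_def det_zero_row)
  next
    fix A :: "real^'d^'d"
    assume diag: "\<And>i j. i \<noteq> j \<Longrightarrow> A $ i $ j = 0"
    have det: "det A = (\<Prod>i\<in>UNIV. A $ i $ i)" by (rule det_diagonal) (rule diag)
    \<comment> \<open>The diagonal entries as a function on \<open>Basis\<close>; with the offset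
      \<open>0\<close> below, the action takes the shape of
      \<open>lborel_affine_euclidean\<close>.\<close>
    define c where "c b = b \<bullet> (A *v b)" for b
    have c: "c (axis i 1) = A $ i $ i" for i
      by (simp add: c_def inner_axis' matrix_vector_mul_component inner_axis)
    have A: "A *v x = 0 + (\<Sum>b\<in>Basis. (c b * (x \<bullet> b)) *\<^sub>R b)" for x
    proof -
      have "(A *v x) $ i = A $ i $ i * x $ i" for i
        using diag by (simp add: matrix_vector_mult_def sum.remove[of _ i])
      moreover have "((\<Sum>b\<in>Basis. (c b * (x \<bullet> b)) *\<^sub>R b)) $ i = A $ i $ i * x $ i" for i
      proof -
        have "(\<Sum>b\<in>Basis. (c b * (x \<bullet> b)) *\<^sub>R b)
            = (\<Sum>j\<in>UNIV. (A $ j $ j * x $ j) *\<^sub>R axis j 1)"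
          by (simp add: Basis_vec_def UNION_singleton_eq_range sum.reindex inj_on_def axis_eq_axis c
              inner_axis)
        then show ?thesis by (simp add: axis_def if_distrib cong: if_cong)
      qed
      ultimately show ?thesis by (simp add: vec_eq_iff)
    qed
    show "P A"
      unfolding P_def
    proof (intro impI ballI)
      fix h :: "real^'d \<Rightarrow> ennreal"
      assume nz: "det A \<noteq> 0" and [measurable]: "h \<in> borel_measurable borel"
      have "c b \<noteq> 0" if "b \<in> Basis" for b
        using that nz c by (auto simp: Basis_vec_def det)
      then have "lborel = density (distr lborel borel ((*v) A)) (\<lambda>_. ennreal (\<Prod>b\<in>Basis. \<bar>c b\<bar>))"
        using lborel_affine_euclidean[of c 0] unfolding A[symmetric] by blast
      also have "(\<Prod>b\<in>Basis. \<bar>c b\<bar>) = \<bar>det A\<bar>"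
        by (simp add: prod_Basis_vec c det abs_prod)
      finally have "lborel = density (distr lborel borel ((*v) A)) (\<lambda>_. ennreal \<bar>det A\<bar>)" .
      then have "(\<integral>\<^sup>+x. h x \<partial>lborel)
          = (\<integral>\<^sup>+x. h x \<partial>density (distr lborel borel ((*v) A)) (\<lambda>_. ennreal \<bar>det A\<bar>))" by simp
      then show "(\<integral>\<^sup>+x. h x \<partial>lborel) = ennreal \<bar>det A\<bar> * (\<integral>\<^sup>+x. h (A *v x) \<partial>lborel)"
        by (simp add: nn_integral_density nn_integral_distr nn_integral_cmult)
    qed
  next
    fix m n :: 'd
    let ?p = "Transposition.transpose m n"
    let ?S = "\<chi> i j. mat 1 $ i $ ?p j :: real^'d^'d"
    have S: "?S *v x = (\<chi> i. x $ ?p i)" for x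
    proof -
      have "(if i = ?p j then 1 else 0) * x $ j = (if j = ?p i then x $ j else 0)" for i j
        by (auto simp: transpose_eq_iff)
      then show ?thesis by (simp add: vec_eq_iff matrix_vector_mult_def mat_def)
    qed
    have det: "\<bar>det ?S\<bar> = 1"
      by (subst det_permute_columns) (auto simp: permutes_swap_id sign_def)
    have [measurable]: "(\<lambda>x :: real^'d. \<chi> i. x $ ?p i) \<in> borel \<rightarrow>\<^sub>M borel"
      by (intro borel_measurable_continuous_onI continuous_intros)
    have perm: "(\<integral>\<^sup>+x. h x \<partial>lborel) = (\<integral>\<^sup>+x. h (\<chi> i. x $ ?p i) \<partial>lborel)"
      if [measurable]: "h \<in> borel_measurable borel" for h :: "real^'d \<Rightarrow> ennreal"
      by (subst lborel_permute_coordinates[of ?p]) (auto simp: nn_integral_distr)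
    show "P ?S"
      unfolding P_def S det
    proof (intro impI ballI)
      fix h :: "real^'d \<Rightarrow> ennreal"
      assume "h \<in> borel_measurable borel"
      from perm[OF this]
      show "(\<integral>\<^sup>+x. h x \<partial>lborel) = ennreal 1 * (\<integral>\<^sup>+x. h (\<chi> i. x $ ?p i) \<partial>lborel)"
        unfolding ennreal_1 mult_1 .
    qed
  next
    fix m n :: 'd and c :: real
    assume mn: "m \<noteq> n"
    let ?S = "\<chi> i j. if i = m \<and> j = n then c else of_bool (i = j) :: real^'d^'d"
    have "?S = (\<chi> k. if k = m then row m (mat 1) + c *s row n (mat 1) else row k (mat 1))"
      using mn by (auto simp: vec_eq_iff row_def mat_def)
    then have "det ?S = 1" by (simp add: det_row_operation[OF mn])
    moreover have "?S *v x = x + (c * x $ n) *\<^sub>R axis m 1" for x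
    proof -
      have "(if i = m \<and> j = n then c else of_bool (i = j)) * x $ j
          = (if j = i then x $ j else 0) + (if j = n then if i = m then c * x $ j else 0 else 0)" for i j
        using mn by auto
      then show ?thesis by (simp add: vec_eq_iff matrix_vector_mult_def sum.distrib axis_def)
    qed
    ultimately show "P ?S" unfolding P_def using nn_integral_lborel_shear[OF _ mn] by simp
  qed
  then show ?thesis using assms unfolding P_def by blast
qed

section \<open>Linear images of the standard Gaussian\<close>

text \<open>As \<open>K\<close> undoes \<open>L\<close>, substituting \<open>L *v x\<close> into the
  density leaves the standard one times \<open>\<bar>det K\<bar>\<close>, which cancels the Jacobian
  \<open>\<bar>det L\<bar>\<close>.\<close>

lemma distr_std_gauss:
  fixes L :: "real^'d^'d"
  assumes "L ** K = mat 1"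
  shows "distr std_gauss borel ((*v) L) = density lborel (gaussian_density K)"
proof (rule measure_eqI)
  fix X assume "X \<in> sets (distr (std_gauss :: (real^'d) measure) borel ((*v) L))"
  then have X [measurable]: "X \<in> sets borel" by simp
  have KL: "K ** L = mat 1" using assms by (simp add: matrix_left_right_inverse)
  have d: "\<bar>det L\<bar> * \<bar>det K\<bar> = 1" using assms by (metis abs_mult abs_one det_I det_mul)
  have g: "gaussian_density K (L *v x) = \<bar>det K\<bar> * gaussian_density (mat 1) x" for x
    using KL by (simp add: gaussian_density_def matrix_vector_mul_assoc)
  have "emeasure (density lborel (gaussian_density K)) X
      = (\<integral>\<^sup>+x. ennreal (gaussian_density K x) * indicator X x \<partial>lborel)"
    by (simp add: emeasure_density)
  also have "\<dots> = ennreal \<bar>det L\<bar> * (\<integral>\<^sup>+x. ennreal (gaussian_density K (L *v x)) * indicator X (L *v x) \<partial>lborel)"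
    using d by (intro nn_integral_lborel_linear) auto
  also have "\<dots> = (\<integral>\<^sup>+x. ennreal \<bar>det L\<bar> * (ennreal (gaussian_density K (L *v x)) * indicator X (L *v x)) \<partial>lborel)"
    by (rule nn_integral_cmult[symmetric]) measurable
  also have "\<dots> = (\<integral>\<^sup>+x. ennreal (gaussian_density (mat 1) x) * indicator ((*v) L -` X) x \<partial>lborel)"
  proof (intro nn_integral_cong)
    fix x
    have "ennreal \<bar>det L\<bar> * gaussian_density K (L *v x) = gaussian_density (mat 1) x"
      unfolding g using d by (simp add: gaussian_density_nonneg flip: ennreal_mult mult.assoc)
    then show "ennreal \<bar>det L\<bar> * (ennreal (gaussian_density K (L *v x)) * indicator X (L *v x))
      = ennreal (gaussian_density (mat 1) x) * indicator ((*v) L -` X) x"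
      by (auto simp: indicator_def simp flip: mult.assoc)
  qed
  also have "\<dots> = emeasure std_gauss ((*v) L -` X)"
    unfolding std_gauss_eq
    by (subst emeasure_density) (auto intro: measurable_sets_borel[OF measurable_matrix_vector_mult])
  also have "\<dots> = emeasure (distr std_gauss borel ((*v) L)) X"
    by (subst emeasure_distr) (auto simp: std_gauss_eq)
  finally show "emeasure (distr std_gauss borel ((*v) L)) X = emeasure (density lborel (gaussian_density K)) X"
    by simp
qed simp

text \<open>No integral is computed: the density belongs to the image of a probability
  measure.\<close>

lemma nn_integral_gaussian_density:
  fixes R :: "real^'d^'d"
  assumes "det R \<noteq> 0"
  shows "(\<integral>\<^sup>+x. gaussian_density R x \<partial>lborel) = 1"
proof -
  obtain L where L: "L ** R = mat 1"
    using assms by (metis invertible_det_nz invertible_def)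
  interpret S: prob_space "std_gauss :: (real^'d) measure" by (rule prob_space_std_gauss)
  interpret prob_space "distr std_gauss borel ((*v) L)"
    by (rule S.prob_space_distr) (simp add: std_gauss_eq)
  show ?thesis
    using emeasure_space_1 unfolding distr_std_gauss[OF L] by (simp add: emeasure_density)
qed

lemma matrix_inv_inverse:
  fixes A :: "real^'n^'n"
  assumes "invertible A"
  shows "A ** matrix_inv A = mat 1" "matrix_inv A ** A = mat 1"
  using someI_ex[OF assms[unfolded invertible_def]] by (auto simp: matrix_inv_def)

text \<open>The factor chosen by \<open>SOME\<close> is unknown, but the density depends on a factor
  only through the absolute value of its determinant and the norms it induces, and the Gram matrix
  determines both.\<close>

lemma gauss_eq_density:
  fixes R :: "real^'d^'d" and A :: "real^'d^'n"
  assumes R: "det R \<noteq> 0" "\<And>x. norm (R *v x) = norm (A *v x)"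
  shows "gauss (matrix_inv (transpose A ** A)) = density lborel (gaussian_density R)"
proof -
  let ?M = "transpose A ** A"
  \<comment> \<open>Polarization: equal norms force equal inner products.\<close>
  have gram: "transpose S ** S = ?M" if "\<And>x. norm (S *v x) = norm (A *v x)" for S :: "real^'d^'d"
  proof (subst matrix_eq, rule allI)
    fix x
    have pol: "(S *v y) \<bullet> (S *v x) = (A *v y) \<bullet> (A *v x)" for y
      using that[of y] that[of x] that[of "y + x"]
      by (simp add: norm_eq inner_add matrix_vector_right_distrib inner_commute)
    have "y \<bullet> ((transpose S ** S) *v x) = y \<bullet> (?M *v x)" for y
      using pol[of y] by (metis dot_lmul_matrix inner_commute matrix_vector_mul_assoc transpose_matrix_vector)
    then show "(transpose S ** S) *v x = ?M *v x" using vector_eq_rdot by (metis inner_commute)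
  qed
  have RM: "transpose R ** R = ?M" using R(2) by (rule gram)
  obtain K where K: "R ** K = mat 1" "K ** R = mat 1"
    using R(1) by (metis invertible_det_nz invertible_def)
  have detM: "det ?M = (det R)\<^sup>2" by (simp add: det_mul power2_eq_square flip: RM)
  have "invertible ?M" using R(1) detM by (simp add: invertible_det_nz)
  then have inv: "matrix_inv ?M ** ?M = mat 1" "?M ** matrix_inv ?M = mat 1"
    by (auto simp: matrix_inv_inverse)
  have "(K ** transpose K) ** ?M = K ** (transpose K ** transpose R) ** R"
    by (simp add: matrix_mul_assoc flip: RM)
  also have "\<dots> = mat 1" using K by (simp flip: matrix_transpose_mul)
  finally have "K ** transpose K = matrix_inv ?M"
    by (metis inv(2) matrix_mul_assoc matrix_mul_lid matrix_mul_rid)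
  \<comment> \<open>The inverse \<open>K\<close> of \<open>R\<close> supplies a witness, so the
    choice in \<open>gauss\<close> does satisfy its equation.\<close>
  then have ex: "\<exists>L :: real^'d^'d. L ** transpose L = matrix_inv ?M" by blast
  define L where "L = (SOME L :: real^'d^'d. L ** transpose L = matrix_inv ?M)"
  have L: "L ** transpose L = matrix_inv ?M" unfolding L_def by (rule someI_ex[OF ex])
  have "det L * det L * det ?M = 1"
    using inv(1) unfolding L[symmetric] by (metis det_I det_mul det_transpose)
  then have "det L \<noteq> 0" by auto
  then obtain S where S: "L ** S = mat 1" "S ** L = mat 1"
    by (metis invertible_det_nz invertible_def)
  have "(transpose S ** S) ** matrix_inv ?M = transpose S ** (S ** L) ** transpose L"
    by (simp add: matrix_mul_assoc flip: L)
  also have "\<dots> = mat 1" using S by (simp flip: matrix_transpose_mul)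
  finally have SM: "transpose S ** S = ?M"
    by (metis inv(1) matrix_mul_assoc matrix_mul_lid matrix_mul_rid)
  have "(det S)\<^sup>2 = (det R)\<^sup>2"
    unfolding detM[symmetric] by (simp add: det_mul power2_eq_square flip: SM)
  then have "\<bar>det S\<bar> = \<bar>det R\<bar>" by (simp add: power2_eq_iff abs_eq_iff)
  moreover have "norm (S *v x) = norm (R *v x)" for x
  proof -
    have "(S *v x) \<bullet> (S *v x) = (R *v x) \<bullet> (R *v x)"
      by (metis RM SM dot_lmul_matrix inner_commute matrix_vector_mul_assoc transpose_matrix_vector)
    then show ?thesis by (simp add: norm_eq)
  qed
  ultimately have "gaussian_density S = gaussian_density R"
    by (simp add: gaussian_density_def fun_eq_iff)
  then show ?thesis
    using distr_std_gauss[OF S(1)] by (simp add: gauss_def L_def)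
qed

section \<open>Measurability of the matrix inverse\<close>

lemma borel_measurable_matrixI:
  fixes f :: "'a \<Rightarrow> real^'m^'n"
  assumes "\<And>i j. (\<lambda>x. f x $ i $ j) \<in> borel_measurable M"
  shows "f \<in> borel_measurable M"
  unfolding borel_measurable_euclidean_space[of f]
  using assms by (auto simp: Basis_vec_def inner_axis)

lemma borel_measurable_matrix_entry: "(\<lambda>A. (A :: real^'m^'n) $ i $ j) \<in> borel_measurable borel"
  by (intro borel_measurable_continuous_onI continuous_intros)

lemma borel_measurable_det:
  fixes f :: "'a \<Rightarrow> real^'n^'n"
  assumes [measurable]: "\<And>i j. (\<lambda>x. f x $ i $ j) \<in> borel_measurable M"
  shows "(\<lambda>x. det (f x)) \<in> borel_measurable M"
  unfolding det_def by measurable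

lemma matrix_inv_cramer:
  fixes A :: "real^'n^'n"
  assumes "det A \<noteq> 0"
  shows "matrix_inv A $ k $ l = det (\<chi> i j. if j = k then axis l 1 $ i else A $ i $ j) / det A"
proof -
  have "A *v (matrix_inv A *v axis l 1) = axis l 1"
    using assms by (simp add: matrix_vector_mul_assoc matrix_inv_inverse invertible_det_nz)
  then have "(matrix_inv A *v axis l 1) $ k
      = det (\<chi> i j. if j = k then axis l 1 $ i else A $ i $ j) / det A"
    by (subst (asm) cramer[OF assms]) simp
  then show ?thesis by (simp add: matrix_vector_mul_component inner_axis)
qed

lemma measurable_matrix_inv: "(matrix_inv :: real^'n^'n \<Rightarrow> _) \<in> borel_measurable borel"
proof (rule borel_measurable_matrixI)
  fix k l :: 'n
  note [measurable] = borel_measurable_matrix_entry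
  have [measurable]: "(\<lambda>A :: real^'n^'n. det A) \<in> borel_measurable borel"
    by (intro borel_measurable_det) measurable
  have [measurable]: "(\<lambda>A :: real^'n^'n. det (\<chi> i j. if j = k then axis l 1 $ i else A $ i $ j))
      \<in> borel_measurable borel"
    by (intro borel_measurable_det) simp
  \<comment> \<open>For a singular matrix the predicate behind \<open>matrix_inv\<close> is
    identically false, so the choice returns one and the same matrix for all of them; elsewhere
    Cramer's rule gives a quotient of polynomials in the entries.\<close>
  define Z :: "real^'n^'n" where "Z = (SOME _. False)"
  have "matrix_inv A = Z" if "det A = 0" for A :: "real^'n^'n"
  proof -
    have "\<not> invertible A" using that by (simp add: invertible_det_nz)
    then have "(\<lambda>B. A ** B = mat 1 \<and> B ** A = mat 1) = (\<lambda>_. False)"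
      by (auto simp: invertible_def)
    then show ?thesis by (simp add: matrix_inv_def Z_def)
  qed
  then have "matrix_inv A $ k $ l = (if det A = 0 then Z $ k $ l
      else det (\<chi> i j. if j = k then axis l 1 $ i else A $ i $ j) / det A)" for A :: "real^'n^'n"
    by (simp add: matrix_inv_cramer)
  then show "(\<lambda>A :: real^'n^'n. matrix_inv A $ k $ l) \<in> borel_measurable borel"
    by simp
qed

lemma measurable_outer: "(outer :: real^'n \<Rightarrow> _) \<in> borel_measurable borel"
proof (rule borel_measurable_matrixI)
  fix i j :: 'n
  show "(\<lambda>x. outer x $ i $ j) \<in> borel_measurable borel"
    by (simp add: outer_def borel_measurable_continuous_onI continuous_intros)
qed

section \<open>Likelihood ratios on product spaces\<close>

lemma density_PiM:
  assumes "prob_space Q" "prob_space (density Q r)" "finite I"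
    and [measurable]: "r \<in> borel_measurable Q"
  shows "PiM I (\<lambda>_. density Q r) = density (PiM I (\<lambda>_. Q)) (\<lambda>g. \<Prod>i\<in>I. r (g i))"
proof -
  interpret Q: prob_space Q by fact
  interpret P: prob_space "density Q r" by fact
  interpret QQ: product_sigma_finite "\<lambda>_. Q" ..
  interpret PP: product_sigma_finite "\<lambda>_. density Q r" ..
  show ?thesis
  proof (rule PP.PiM_eqI[symmetric])
    show "sets (density (PiM I (\<lambda>_. Q)) (\<lambda>g. \<Prod>i\<in>I. r (g i))) = sets (PiM I (\<lambda>_. density Q r))"
      by (simp cong: sets_PiM_cong)
    fix A assume "\<And>i. i \<in> I \<Longrightarrow> A i \<in> sets (density Q r)"
    then have A [measurable]: "\<And>i. i \<in> I \<Longrightarrow> A i \<in> sets Q" by simp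
    have "emeasure (density (PiM I (\<lambda>_. Q)) (\<lambda>g. \<Prod>i\<in>I. r (g i))) (Pi\<^sub>E I A)
        = (\<integral>\<^sup>+g. (\<Prod>i\<in>I. r (g i)) * indicator (Pi\<^sub>E I A) g \<partial>PiM I (\<lambda>_. Q))"
      using A assms(3) by (intro emeasure_density) (auto intro!: sets_PiM_I_finite)
    also have "\<dots> = (\<integral>\<^sup>+g. (\<Prod>i\<in>I. r (g i) * indicator (A i) (g i)) \<partial>PiM I (\<lambda>_. Q))"
    proof (intro nn_integral_cong)
      fix g assume "g \<in> space (PiM I (\<lambda>_. Q))"
      then have "indicator (Pi\<^sub>E I A) g = (\<Prod>i\<in>I. indicator (A i) (g i) :: ennreal)"
        using assms(3)
        by (cases "g \<in> Pi\<^sub>E I A") (auto simp: space_PiM PiE_def Pi_iff indicator_def intro!: prod_zero[symmetric])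
      then show "(\<Prod>i\<in>I. r (g i)) * indicator (Pi\<^sub>E I A) g = (\<Prod>i\<in>I. r (g i) * indicator (A i) (g i))"
        by (simp add: prod.distrib)
    qed
    also have "\<dots> = (\<Prod>i\<in>I. \<integral>\<^sup>+x. r x * indicator (A i) x \<partial>Q)"
      using assms(3) by (intro QQ.product_nn_integral_prod) auto
    also have "\<dots> = (\<Prod>i\<in>I. emeasure (density Q r) (A i))"
      by (intro prod.cong refl) (auto simp: emeasure_density)
    finally show "emeasure (density (PiM I (\<lambda>_. Q)) (\<lambda>g. \<Prod>i\<in>I. r (g i))) (Pi\<^sub>E I A)
      = (\<Prod>i\<in>I. emeasure (density Q r) (A i))" .
  qed fact
qed

text \<open>Markov's inequality for the \<open>lam\<close>-th power of the likelihood ratio.\<close>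

lemma product_privacy:
  fixes r :: "'a \<Rightarrow> real"
  assumes "prob_space Q" "prob_space P" and P: "P = density Q r"
    and [measurable]: "r \<in> borel_measurable Q" and pos: "\<And>x. r x > 0"
    and "lam > 0" "c \<ge> 0" "del \<ge> 0"
    and moment: "(\<integral>\<^sup>+x. ennreal (r x powr lam) \<partial>P) \<le> ennreal c"
    and c: "c ^ m \<le> exp (lam * eps) * del"
    and T: "T \<in> sets (PiM {..<m} (\<lambda>_. P))"
  shows "measure (PiM {..<m} (\<lambda>_. P)) T \<le> exp eps * measure (PiM {..<m} (\<lambda>_. Q)) T + del"
proof -
  interpret Q: prob_space Q by fact
  interpret P: prob_space P by fact
  interpret PS: product_sigma_finite "\<lambda>_. P" ..
  let ?PP = "PiM {..<m} (\<lambda>_. P)" and ?QQ = "PiM {..<m} (\<lambda>_. Q)"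
  interpret QQ: prob_space ?QQ by (intro prob_space_PiM) (rule assms)
  interpret PP: prob_space ?PP by (intro prob_space_PiM) (rule assms)
  have sP: "sets P = sets Q" by (simp add: P)
  have sPP: "sets ?PP = sets ?QQ" by (intro sets_PiM_cong) (auto simp: sP)
  have [measurable]: "r \<in> borel_measurable P" by (simp add: P)
  define F where "F g = (\<Prod>i<m. r (g i))" for g :: "nat \<Rightarrow> 'a"
  have Fpos: "F g > 0" for g unfolding F_def using pos by (intro prod_pos) auto
  have FQ [measurable]: "F \<in> borel_measurable ?QQ" unfolding F_def by measurable
  have FP [measurable]: "F \<in> borel_measurable ?PP" unfolding F_def by measurable
  have PP: "?PP = density ?QQ F"
    using density_PiM[OF assms(1), of "\<lambda>x. ennreal (r x)" "{..<m}"] assms(2)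
    by (simp add: P F_def prod_ennreal pos less_imp_le)
  \<comment> \<open>Off \<open>Bad\<close> the ratio \<open>F\<close> is at most
    \<open>exp eps\<close>, which gives the multiplicative part of the bound; the mass of
    \<open>Bad\<close> is the additive part.\<close>
  define Bad where "Bad = {g \<in> space ?PP. exp eps < F g}"
  have Bad [measurable]: "Bad \<in> sets ?PP" unfolding Bad_def by measurable
  have TQ [measurable]: "T \<in> sets ?QQ" "Bad \<in> sets ?QQ" using T Bad sPP by auto
  have "emeasure ?PP (T - Bad) = (\<integral>\<^sup>+g. ennreal (F g) * indicator (T - Bad) g \<partial>?QQ)"
    unfolding PP by (intro emeasure_density) auto
  also have "\<dots> \<le> (\<integral>\<^sup>+g. ennreal (exp eps) * indicator T g \<partial>?QQ)"
    using sets.sets_into_space[OF T]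
    by (intro nn_integral_mono) (auto simp: indicator_def Bad_def not_less intro!: ennreal_leI)
  also have "\<dots> = ennreal (exp eps) * emeasure ?QQ T"
    by (simp add: nn_integral_cmult)
  finally have good: "measure ?PP (T - Bad) \<le> exp eps * measure ?QQ T"
    by (simp add: PP.emeasure_eq_measure QQ.emeasure_eq_measure flip: ennreal_mult)
  have "emeasure ?PP Bad = (\<integral>\<^sup>+g. indicator Bad g \<partial>?PP)" by simp
  \<comment> \<open>The power of \<open>F\<close> is a product over the samples, so its integral
    factors into \<open>m\<close> copies of the single-sample moment.\<close>
  also have "\<dots> \<le> (\<integral>\<^sup>+g. ennreal (exp (- (lam * eps))) * (\<Prod>i<m. ennreal (r (g i) powr lam)) \<partial>?PP)"
  proof (intro nn_integral_mono)
    fix g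
    have "1 \<le> exp (- (lam * eps)) * F g powr lam" if "exp eps < F g"
    proof -
      have "exp (lam * eps) \<le> F g powr lam"
        using powr_mono2[of lam "exp eps" "F g"] that assms(6) by (simp add: powr_def mult.commute)
      then show ?thesis by (simp add: exp_minus field_simps)
    qed
    moreover have "(\<Prod>i<m. ennreal (r (g i) powr lam)) = ennreal (F g powr lam)"
      using pos by (simp add: F_def prod_ennreal prod_powr_distrib less_imp_le)
    ultimately show "indicator Bad g \<le> ennreal (exp (- (lam * eps))) * (\<Prod>i<m. ennreal (r (g i) powr lam))"
      by (auto simp: indicator_def Bad_def simp flip: ennreal_mult)
  qed
  also have "\<dots> = ennreal (exp (- (lam * eps))) * (\<Prod>i<m. \<integral>\<^sup>+x. ennreal (r x powr lam) \<partial>P)"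
    by (subst nn_integral_cmult)
       (auto simp: PS.product_nn_integral_prod[where f = "\<lambda>_ x. ennreal (r x powr lam)"])
  also have "\<dots> \<le> ennreal (exp (- (lam * eps))) * (\<Prod>i<m. ennreal c)"
    using moment by (intro mult_left_mono prod_mono_ennreal) auto
  also have "\<dots> = ennreal (exp (- (lam * eps)) * c ^ m)"
    using assms(7) by (simp add: ennreal_power ennreal_mult)
  finally have "measure ?PP Bad \<le> exp (- (lam * eps)) * c ^ m"
    using assms(7) by (simp add: PP.emeasure_eq_measure)
  also have "\<dots> \<le> del" using c by (simp add: exp_minus field_simps)
  finally have bad: "measure ?PP Bad \<le> del" .
  have "measure ?PP T \<le> measure ?PP ((T - Bad) \<union> Bad)"
    using T by (intro PP.finite_measure_mono) auto
  also have "\<dots> \<le> measure ?PP (T - Bad) + measure ?PP Bad"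
    using T by (intro measure_Un_le) auto
  finally show ?thesis using good bad by linarith
qed

section \<open>Scalar estimates and the choice of the order\<close>

text \<open>The bound \<open>ln z \<le> z - 1\<close> at the reciprocal. Here and in the next lemma
  the linear term keeps the exact \<open>x\<close>, because it has to cancel later, and only the
  remainder is relaxed to the uniform \<open>u\<close>.\<close>

lemma neg_ln_one_plus_le:
  fixes x u :: real
  assumes "0 \<le> x" "x \<le> u"
  shows "- ln (1 + x) \<le> - x + u\<^sup>2"
proof -
  have "- ln (1 + x) = ln (1 / (1 + x))" using assms by (simp add: ln_div)
  also have "\<dots> \<le> 1 / (1 + x) - 1" using assms by (intro ln_le_minus_one) simp
  also have "\<dots> \<le> - x + x\<^sup>2"
    using assms by (simp add: field_simps power2_eq_square)
  also have "x\<^sup>2 \<le> u\<^sup>2" using assms by (intro power_mono)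
  finally show ?thesis by simp
qed

lemma neg_ln_one_minus_le:
  fixes x y u :: real
  assumes "y \<le> x" "0 \<le> x" "x \<le> u" "u < 1"
  shows "- ln (1 - y) \<le> x + u\<^sup>2 / (1 - u)"
proof -
  have "- ln (1 - y) \<le> - ln (1 - x)" using assms by simp
  also have "\<dots> = ln (1 / (1 - x))" using assms by (simp add: ln_div)
  also have "\<dots> \<le> 1 / (1 - x) - 1" using assms by (intro ln_le_minus_one) simp
  also have "\<dots> = x + x\<^sup>2 / (1 - x)"
    using assms by (simp add: field_simps power2_eq_square)
  also have "x\<^sup>2 / (1 - x) \<le> u\<^sup>2 / (1 - u)" using assms by (intro frac_le power_mono) auto
  finally show ?thesis by simp
qed

text \<open>The terms linear in \<open>s\<close> and \<open>s'\<close> cancel, so the left-hand side is of second order in \<open>t\<close>.\<close>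

lemma log_det_bound:
  fixes s s' y y' t lam :: real
  assumes "0 \<le> s" "s \<le> t" "y \<le> s" "0 \<le> s'" "s' \<le> t" "y' \<le> s'"
    and "lam > 0" "lam * t < 1" "t < 1"
  shows "- lam * ln (1 + s') - lam * ln (1 - y) - ln (1 + lam * s) - ln (1 - lam * y')
    \<le> lam * t\<^sup>2 / (1 - t) + lam * t\<^sup>2 + (lam * t)\<^sup>2 + (lam * t)\<^sup>2 / (1 - lam * t)"
proof -
  \<comment> \<open>Of the four estimates, the first cancels linearly against the fourth and the
    second against the third.\<close>
  have "lam * (- ln (1 + s')) \<le> lam * (- s' + t\<^sup>2)"
    using assms by (intro mult_left_mono neg_ln_one_plus_le) auto
  moreover have "lam * (- ln (1 - y)) \<le> lam * (s + t\<^sup>2 / (1 - t))"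
    using assms by (intro mult_left_mono neg_ln_one_minus_le) auto
  moreover have "- ln (1 + lam * s) \<le> - (lam * s) + (lam * t)\<^sup>2"
    using assms by (intro neg_ln_one_plus_le mult_left_mono) auto
  moreover have "- ln (1 - lam * y') \<le> lam * s' + (lam * t)\<^sup>2 / (1 - lam * t)"
    using assms by (intro neg_ln_one_minus_le mult_left_mono) auto
  ultimately show ?thesis by (simp add: algebra_simps)
qed

text \<open>Put \<open>k = lam * t\<close> and \<open>L = nu * q^2\<close>. The moment costs about
  nu k^2 plus small terms in \<open>t\<close>, while \<open>lam * eps\<close> is at least k nu (2.8
  q + 2 q^2). For small \<open>q\<close> and \<open>k\<close> near \<open>q\<close> this sets a gain
  of 2.8 nu q^2 against 2 nu q^2 for the moment and \<open>L\<close> together.\<close>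

lemma privacy_budget:
  fixes eps L t :: real and nu :: nat
  assumes "eps > 0" "L > 0" "nu > 0" "t > 0" "eps < 2 * L"
    and t: "t * (2 * sqrt (2 * real nu * L) + 2 * L) = eps * (1 - eps / (2 * L))"
  obtains lam where "lam > 0" "lam * t < 1" "t < 1"
    "real nu / 2 * (lam * t\<^sup>2 / (1 - t) + lam * t\<^sup>2 + (lam * t)\<^sup>2 + (lam * t)\<^sup>2 / (1 - lam * t))
      \<le> lam * eps - L"
proof -
  define q where "q = sqrt (L / nu)"
  \<comment> \<open>The solution of \<open>k / (1 - k) = q\<close>. It removes the fraction from the
    last remainder and gives \<open>L = nu * q * (k * (1 + q))\<close>, so that
    \<open>nu * k\<close> divides out of the whole inequality.\<close>
  define k where "k = q / (1 + q)"
  have q: "q > 0" using assms by (simp add: q_def)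
  have L: "L = q\<^sup>2 * nu" using assms by (simp add: q_def)
  have sq: "sqrt (2 * real nu * L) = sqrt 2 * q * nu"
    using q by (simp add: L real_sqrt_mult power2_eq_square)
  \<comment> \<open>A rational stand-in for the square root, whence 2.8 = 2 * 1.4 below.\<close>
  have s2: "1.4 \<le> sqrt (2 :: real)" by (rule real_le_rsqrt) (simp add: power2_eq_square)
  have H: "nu * (2.8 * q + 2 * q\<^sup>2) \<le> 2 * sqrt (2 * real nu * L) + 2 * L"
  proof -
    have "1.4 * (q * nu) \<le> sqrt 2 * (q * nu)"
      using s2 q by (intro mult_right_mono) auto
    then show ?thesis unfolding sq by (simp add: L algebra_simps)
  qed
  have tH: "t * (nu * (2.8 * q + 2 * q\<^sup>2)) \<le> eps * (1 - eps / (2 * L))"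
    using H assms(4) unfolding t[symmetric] by (intro mult_left_mono) auto
  \<comment> \<open>The maximum over \<open>eps\<close> is attained at \<open>eps = L\<close>. This
    bounds \<open>t\<close> in terms of \<open>q\<close> alone.\<close>
  have "eps * (1 - eps / (2 * L)) \<le> L / 2"
  proof -
    have "0 \<le> (eps - L)\<^sup>2" by simp
    then show ?thesis using assms(2) by (simp add: field_simps power2_eq_square)
  qed
  with tH have "t * (nu * (2.8 * q + 2 * q\<^sup>2)) \<le> q\<^sup>2 * nu / 2" using L by linarith
  then have "(nu * q) * (t * (2.8 + 2 * q)) \<le> (nu * q) * (q / 2)"
    by (simp add: power2_eq_square algebra_simps)
  then have tq: "t * (2.8 + 2 * q) \<le> q / 2"
    by (rule mult_left_le_imp_le) (use q assms(3) in simp)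
  then have "t * 2.8 + 2 * (t * q) \<le> q / 2" by (simp add: algebra_simps)
  moreover have "t * q > 0" using assms(4) q by simp
  ultimately have tq5: "t \<le> q / 5" and "2 * (t * q) \<le> q / 2" using q assms(4) by linarith+
  then have t4: "t \<le> 1 / 4" using q by (simp add: field_simps)
  have k: "0 < k" "k < 1" "k \<le> q" "k / (1 - k) = q" "k * (1 + q) = q"
    using q by (auto simp: k_def field_simps)
  \<comment> \<open>A second use of the equation for \<open>t\<close>: dropping the factor, which is
    at most 1, bounds \<open>eps\<close> from below.\<close>
  have "eps * (1 - eps / (2 * L)) \<le> eps"
    using assms by (simp add: field_simps)
  then have eps: "t * (nu * (2.8 * q + 2 * q\<^sup>2)) \<le> eps" using tH by linarith
  define lam where "lam = k / t"
  have lt: "lam * t = k" using assms(4) by (simp add: lam_def)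
  have "t / (1 - t) \<le> t * (4 / 3)"
    using t4 assms(4) by (simp add: field_simps)
  \<comment> \<open>After division by \<open>nu * k\<close>, 1.8 q + q^2 is what 2.8 q + 2 q^2
    leaves once \<open>L\<close> has taken q (1 + q).\<close>
  then have "t / (1 - t) + t + k + q \<le> 2 * (1.8 * q + q\<^sup>2)"
    using tq5 k(3) q zero_le_power2[of q] by argo
  then have "(t / (1 - t) + t + k + q) / 2 \<le> 1.8 * q + q\<^sup>2" by simp
  then have "(nu * k) * ((t / (1 - t) + t + k + q) / 2) \<le> (nu * k) * (1.8 * q + q\<^sup>2)"
    using k by (intro mult_left_mono) auto
  moreover have "(nu * k) * ((t / (1 - t) + t + k + q) / 2)
     = real nu / 2 * (lam * t\<^sup>2 / (1 - t) + lam * t\<^sup>2 + (lam * t)\<^sup>2 + (lam * t)\<^sup>2 / (1 - lam * t))"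
  proof -
    define z where "z = t / (1 - t)"
    have "lam * t\<^sup>2 / (1 - t) = k * z" "lam * t\<^sup>2 = k * t"
      by (simp_all add: z_def power2_eq_square flip: lt mult.assoc)
    moreover have "(lam * t)\<^sup>2 / (1 - lam * t) = k * q"
      unfolding lt k(4)[symmetric] by (simp add: power2_eq_square)
    ultimately show ?thesis
      unfolding z_def[symmetric] lt by (simp only: power2_eq_square[of k]) (simp add: algebra_simps)
  qed
  moreover have "(nu * k) * (1.8 * q + q\<^sup>2) \<le> lam * eps - L"
  proof -
    have "k * (nu * (2.8 * q + 2 * q\<^sup>2)) = lam * (t * (nu * (2.8 * q + 2 * q\<^sup>2)))"
      by (simp flip: lt)
    also have "\<dots> \<le> lam * eps"
      using eps k(1) assms(4) by (intro mult_left_mono) (auto simp: lam_def)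
    finally have "k * (nu * (2.8 * q + 2 * q\<^sup>2)) \<le> lam * eps" .
    moreover have "L = nu * q * (k * (1 + q))" unfolding k(5) by (simp add: L power2_eq_square)
    ultimately show ?thesis by (simp add: power2_eq_square algebra_simps)
  qed
  ultimately have "real nu / 2 * (lam * t\<^sup>2 / (1 - t) + lam * t\<^sup>2 + (lam * t)\<^sup>2
      + (lam * t)\<^sup>2 / (1 - lam * t)) \<le> lam * eps - L"
    by linarith
  moreover have "lam > 0" "lam * t < 1" "t < 1"
    using k(1,2) t4 assms(4) lt by (auto simp: lam_def)
  ultimately show ?thesis using that by blast
qed

section \<open>The moment and the factors for a neighbouring input\<close>

text \<open>The integrand is again a Gaussian density up to a constant, since the exponents combine
  to the form of \<open>N\<close>. Its total mass is 1, so the constant is the moment.\<close>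

lemma gaussian_moment:
  fixes R S N :: "real^'d^'d"
  assumes "det R \<noteq> 0" "det S \<noteq> 0" "det N \<noteq> 0"
    and N: "\<And>x. (norm (N *v x))\<^sup>2 = (norm (R *v x))\<^sup>2 + lam * ((norm (R *v x))\<^sup>2 - (norm (S *v x))\<^sup>2)"
  shows "(\<integral>\<^sup>+x. ennreal ((gaussian_density R x / gaussian_density S x) powr lam)
      \<partial>density lborel (gaussian_density R))
    = ennreal (\<bar>det R\<bar> * (\<bar>det R\<bar> / \<bar>det S\<bar>) powr lam / \<bar>det N\<bar>)"
proof -
  let ?C = "\<bar>det R\<bar> * (\<bar>det R\<bar> / \<bar>det S\<bar>) powr lam / \<bar>det N\<bar>"
  have pt: "gaussian_density R x * (gaussian_density R x / gaussian_density S x) powr lam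
      = ?C * gaussian_density N x" for x
  proof -
    define k where "k = (1 / sqrt (2 * pi)) ^ CARD('d)"
    have k: "k > 0" by (simp add: k_def)
    define u where "u = (norm (R *v x))\<^sup>2"
    define v where "v = (norm (S *v x))\<^sup>2"
    have "gaussian_density R x / gaussian_density S x = (\<bar>det R\<bar> / \<bar>det S\<bar>) * exp ((v - u) / 2)"
    proof -
      have "exp ((v - u) / 2) = exp (- u / 2) / exp (- v / 2)"
        unfolding exp_diff[symmetric] by (simp add: diff_divide_distrib)
      then show ?thesis
        using k unfolding gaussian_density_def k_def[symmetric] u_def[symmetric] v_def[symmetric]
        by simp
    qed
    then have "(gaussian_density R x / gaussian_density S x) powr lam
        = (\<bar>det R\<bar> / \<bar>det S\<bar>) powr lam * exp ((v - u) / 2) powr lam"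
      by (simp only: powr_mult)
    also have "exp ((v - u) / 2) powr lam = exp (lam * (v - u) / 2)"
      by (simp add: powr_def)
    finally have "(gaussian_density R x / gaussian_density S x) powr lam
        = (\<bar>det R\<bar> / \<bar>det S\<bar>) powr lam * exp (lam * (v - u) / 2)" .
    moreover have "exp (- (norm (N *v x))\<^sup>2 / 2) = exp (- u / 2) * exp (lam * (v - u) / 2)"
      unfolding N u_def[symmetric] v_def[symmetric] exp_add[symmetric]
      by (rule arg_cong[of _ _ exp]) (simp add: field_simps)
    ultimately show ?thesis
      using assms(3) unfolding gaussian_density_def k_def[symmetric] u_def[symmetric]
      by simp
  qed
  have "(\<integral>\<^sup>+x. ennreal ((gaussian_density R x / gaussian_density S x) powr lam)
      \<partial>density lborel (gaussian_density R))
      = (\<integral>\<^sup>+x. ennreal (gaussian_density R x) *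
          ennreal ((gaussian_density R x / gaussian_density S x) powr lam) \<partial>lborel)"
    by (rule nn_integral_density) measurable
  also have "\<dots> = (\<integral>\<^sup>+x. ennreal ?C * ennreal (gaussian_density N x) \<partial>lborel)"
    by (intro nn_integral_cong) (simp add: gaussian_density_nonneg pt flip: ennreal_mult)
  also have "\<dots> = ennreal ?C * (\<integral>\<^sup>+x. ennreal (gaussian_density N x) \<partial>lborel)"
    by (rule nn_integral_cmult) measurable
  also have "\<dots> = ennreal ?C" by (simp add: nn_integral_gaussian_density[OF assms(3)])
  finally show ?thesis .
qed

lemma prob_space_gaussian:
  "det R \<noteq> 0 \<Longrightarrow> prob_space (density lborel (gaussian_density R))"
  by (intro prob_spaceI) (simp add: emeasure_density nn_integral_gaussian_density)

lemma norm_mult_neighbors: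
  fixes A A' :: "real^'d^'n"
  assumes "neighbors A A'"
  obtains i where
    "\<And>x. (norm (A' *v x))\<^sup>2 = (norm (A *v x))\<^sup>2 + (A' $ i \<bullet> x)\<^sup>2 - (A $ i \<bullet> x)\<^sup>2"
proof -
  obtain i where i: "{i. A $ i \<noteq> A' $ i} = {i}"
    using assms unfolding neighbors_def by (metis card_1_singletonE)
  have sq: "(norm (C *v x))\<^sup>2 = (C $ i \<bullet> x)\<^sup>2 + (\<Sum>j\<in>-{i}. (C $ j \<bullet> x)\<^sup>2)"
    for C :: "real^'d^'n" and x
  proof -
    have "(norm (C *v x))\<^sup>2 = (\<Sum>j\<in>UNIV. (C $ j \<bullet> x)\<^sup>2)"
      unfolding power2_norm_eq_inner
      by (subst inner_vec_def) (simp add: matrix_vector_mul_component power2_eq_square)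
    also have "\<dots> = (C $ i \<bullet> x)\<^sup>2 + (\<Sum>j\<in>-{i}. (C $ j \<bullet> x)\<^sup>2)"
      unfolding Compl_eq_Diff_UNIV by (rule sum.remove) auto
    finally show ?thesis .
  qed
  have "A $ j = A' $ j" if "j \<in> -{i}" for j using i that by blast
  then have "(\<Sum>j\<in>-{i}. (A $ j \<bullet> x)\<^sup>2) = (\<Sum>j\<in>-{i}. (A' $ j \<bullet> x)\<^sup>2)" for x
    by (metis (no_types, lifting) sum.cong)
  then show ?thesis using that[of i] by (simp add: sq)
qed

lemma vector_matrix_surj:
  fixes R :: "real^'d^'d"
  assumes "det R \<noteq> 0"
  obtains b where "b v* R = a"
  using matrix_vector_surj[of "transpose R" a] assms by (auto simp: det_transpose)

text \<open>Each of the two forms is reached from that of \<open>R\<close> by adding one square and then subtracting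
  another.  The order matters: the addition can only decrease the dual norm that governs the
  subsequent subtraction.\<close>

lemma neighbor_factors:
  fixes R :: "real^'d^'d"
  assumes R: "det R \<noteq> 0" "\<And>x. w * norm x \<le> norm (R *v x)"
    and w: "w > 0" and a: "norm a \<le> B" "norm a' \<le> B"
    and t: "t = B\<^sup>2 / w\<^sup>2" and lam: "lam > 0" "lam * t < 1" "t < 1"
  obtains S N :: "real^'d^'d" and s s' y y' where
    "\<And>x. (norm (S *v x))\<^sup>2 = (norm (R *v x))\<^sup>2 + (a' \<bullet> x)\<^sup>2 - (a \<bullet> x)\<^sup>2"
    "\<And>x. (norm (N *v x))\<^sup>2 = (norm (R *v x))\<^sup>2 + lam * ((a \<bullet> x)\<^sup>2 - (a' \<bullet> x)\<^sup>2)"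
    "(det S)\<^sup>2 = (det R)\<^sup>2 * (1 + s') * (1 - y)"
    "(det N)\<^sup>2 = (det R)\<^sup>2 * (1 + lam * s) * (1 - lam * y')"
    "0 \<le> s" "s \<le> t" "y \<le> s" "0 \<le> s'" "s' \<le> t" "y' \<le> s'"
proof -
  obtain b where b: "b v* R = a" using R(1) by (rule vector_matrix_surj)
  obtain b' where b': "b' v* R = a'" using R(1) by (rule vector_matrix_surj)
  have bt: "(norm b)\<^sup>2 \<le> t" "(norm b')\<^sup>2 \<le> t"
    unfolding t using dual_norm_bound[OF b R(1) w a(1) R(2)] dual_norm_bound[OF b' R(1) w a(2) R(2)] by auto
  \<comment> \<open>Covers both factors: \<open>k = 1\<close> adds the square of \<open>a'\<close>
    and removes that of \<open>a\<close>, while \<open>k = lam\<close> exchanges the two. The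
    condition \<open>k * t < 1\<close> keeps the form positive after the removal.\<close>
  have update: "\<exists>(U :: real^'d^'d) y. (det U)\<^sup>2 = (det R)\<^sup>2 * (1 + k * (norm p)\<^sup>2) * (1 - k * y)
      \<and> y \<le> (norm q)\<^sup>2
      \<and> (\<forall>x. (norm (U *v x))\<^sup>2 = (norm (R *v x))\<^sup>2 + k * (u \<bullet> x)\<^sup>2 - k * (v \<bullet> x)\<^sup>2)"
    if k: "k > 0" "k * t < 1" and p: "p v* R = u" and q: "q v* R = v" "(norm q)\<^sup>2 \<le> t"
    for k u v p q
  proof -
    have pos: "0 < 1 + k * (norm p)\<^sup>2" using k(1) by (simp add: add_pos_nonneg)
    obtain R1 :: "real^'d^'d" where R1: "(det R1)\<^sup>2 = (det R)\<^sup>2 * (1 + k * (norm p)\<^sup>2)"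
      "\<And>x. (norm (R1 *v x))\<^sup>2 = (norm (R *v x))\<^sup>2 + k * (u \<bullet> x)\<^sup>2"
      using rank_one_factor[OF p pos] by blast
    have "det R1 \<noteq> 0" using R1(1) R(1) pos by auto
    then obtain q1 where q1: "q1 v* R1 = v" by (rule vector_matrix_surj)
    have "norm q1 \<le> norm q"
      using q(1) q1 \<open>det R1 \<noteq> 0\<close> by (rule dual_norm_antimono) (use R1(2) k(1) in simp)
    then have le: "(norm q1)\<^sup>2 \<le> (norm q)\<^sup>2" by (simp add: power_mono)
    have "k * (norm q1)\<^sup>2 \<le> k * t" using order_trans[OF le q(2)] k(1) by (intro mult_left_mono) auto
    then have "0 < 1 + (- k) * (norm q1)\<^sup>2" using k(2) by simp
    from rank_one_factor[OF q1 this] obtain U :: "real^'d^'d" where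
      "(det U)\<^sup>2 = (det R1)\<^sup>2 * (1 + (- k) * (norm q1)\<^sup>2)"
      "\<And>x. (norm (U *v x))\<^sup>2 = (norm (R1 *v x))\<^sup>2 + (- k) * (v \<bullet> x)\<^sup>2" by blast
    then show ?thesis using R1 le by (intro exI[of _ U] exI[of _ "(norm q1)\<^sup>2"]) auto
  qed
  obtain S :: "real^'d^'d" and y where S:
    "(det S)\<^sup>2 = (det R)\<^sup>2 * (1 + 1 * (norm b')\<^sup>2) * (1 - 1 * y)" "y \<le> (norm b)\<^sup>2"
    "\<forall>x. (norm (S *v x))\<^sup>2 = (norm (R *v x))\<^sup>2 + 1 * (a' \<bullet> x)\<^sup>2 - 1 * (a \<bullet> x)\<^sup>2"
    using update[of 1 b' a' b a] b b' bt lam(3) by auto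
  obtain N :: "real^'d^'d" and y' where N:
    "(det N)\<^sup>2 = (det R)\<^sup>2 * (1 + lam * (norm b)\<^sup>2) * (1 - lam * y')" "y' \<le> (norm b')\<^sup>2"
    "\<forall>x. (norm (N *v x))\<^sup>2 = (norm (R *v x))\<^sup>2 + lam * (a \<bullet> x)\<^sup>2 - lam * (a' \<bullet> x)\<^sup>2"
    using update[of lam b a b' a'] b b' bt lam(1,2) by auto
  show ?thesis
    by (rule that[of S N "(norm b')\<^sup>2" y "(norm b)\<^sup>2" y'])
       (use S N bt in \<open>auto simp: right_diff_distrib\<close>)
qed

section \<open>Privacy of the Gaussian samples\<close>

lemma gauss_product_privacy:
  fixes A A' :: "real^'d^'n"
  assumes A: "sigma_min A \<ge> w" "\<And>i. norm (A $ i) \<le> B" "\<And>i. norm (A' $ i) \<le> B"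
    and nb: "neighbors A A'" and w: "w > 0" and del: "del > 0" "L \<ge> - ln del"
    and t: "t = B\<^sup>2 / w\<^sup>2" and lam: "lam > 0" "lam * t < 1" "t < 1"
    and budget: "real nu / 2 * (lam * t\<^sup>2 / (1 - t) + lam * t\<^sup>2 + (lam * t)\<^sup>2 + (lam * t)\<^sup>2 / (1 - lam * t))
      \<le> lam * eps - L"
    and T: "T \<in> sets (PiM {..<nu} (\<lambda>_. borel))"
  shows "measure (PiM {..<nu} (\<lambda>_. gauss (matrix_inv (transpose A ** A)))) T
    \<le> exp eps * measure (PiM {..<nu} (\<lambda>_. gauss (matrix_inv (transpose A' ** A')))) T + del"
proof -
  have lower: "w * norm x \<le> norm (A *v x)" for x using w A(1) by (rule norm_ge_sigma_min)
  have "x = 0" if "A *v x = 0" for x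
    using lower[of x] w that by (simp add: mult_le_0_iff)
  then obtain R :: "real^'d^'d" where R: "det R \<noteq> 0" "\<And>x. norm (R *v x) = norm (A *v x)"
    using square_factor_exists[of A] by blast
  obtain i where i: "\<And>x. (norm (A' *v x))\<^sup>2 = (norm (A *v x))\<^sup>2 + (A' $ i \<bullet> x)\<^sup>2 - (A $ i \<bullet> x)\<^sup>2"
    using norm_mult_neighbors[OF nb] by blast
  obtain S N :: "real^'d^'d" and s s' y y' where
    S: "\<And>x. (norm (S *v x))\<^sup>2 = (norm (R *v x))\<^sup>2 + (A' $ i \<bullet> x)\<^sup>2 - (A $ i \<bullet> x)\<^sup>2" and
    N: "\<And>x. (norm (N *v x))\<^sup>2 = (norm (R *v x))\<^sup>2 + lam * ((A $ i \<bullet> x)\<^sup>2 - (A' $ i \<bullet> x)\<^sup>2)" and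
    dS: "(det S)\<^sup>2 = (det R)\<^sup>2 * (1 + s') * (1 - y)" and
    dN: "(det N)\<^sup>2 = (det R)\<^sup>2 * (1 + lam * s) * (1 - lam * y')" and
    s: "0 \<le> s" "s \<le> t" "y \<le> s" "0 \<le> s'" "s' \<le> t" "y' \<le> s'"
    using neighbor_factors[OF R(1), of w "A $ i" B "A' $ i" t lam] R(2) lower w A(2,3) t lam
    by metis
  have pos: "0 < 1 + s'" "0 < 1 - y" "0 < 1 + lam * s" "0 < 1 - lam * y'"
  proof -
    have "lam * y' \<le> lam * t" using s lam by (intro mult_left_mono) auto
    then show "0 < 1 - lam * y'" using lam by linarith
    show "0 < 1 + lam * s" using s lam by (simp add: add_pos_nonneg)
  qed (use s lam in auto)
  \<comment> \<open>The positive factors in \<open>dS\<close> and \<open>dN\<close> carry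
    nonsingularity over from \<open>R\<close>.\<close>
  have nz: "det S \<noteq> 0" "det N \<noteq> 0" using dS dN pos R(1) by auto
  have ln_abs: "ln \<bar>z\<bar> = ln (z\<^sup>2) / 2" if "z \<noteq> 0" for z :: real
    using that ln_realpow[of "\<bar>z\<bar>" 2] by simp
  have lnS: "ln \<bar>det S\<bar> = ln \<bar>det R\<bar> + (ln (1 + s') + ln (1 - y)) / 2"
    using nz R(1) pos by (simp add: ln_abs dS ln_mult)
  have lnN: "ln \<bar>det N\<bar> = ln \<bar>det R\<bar> + (ln (1 + lam * s) + ln (1 - lam * y')) / 2"
    using nz R(1) pos by (simp add: ln_abs dN ln_mult)
  define c where "c = \<bar>det R\<bar> * (\<bar>det R\<bar> / \<bar>det S\<bar>) powr lam / \<bar>det N\<bar>"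
  have cpos: "c > 0" using R(1) nz by (simp add: c_def)
  have "ln c = ln \<bar>det R\<bar> + lam * (ln \<bar>det R\<bar> - ln \<bar>det S\<bar>) - ln \<bar>det N\<bar>"
    using R(1) nz by (simp add: c_def ln_mult ln_div ln_powr)
  also have "\<dots> = (- lam * ln (1 + s') - lam * ln (1 - y) - ln (1 + lam * s) - ln (1 - lam * y')) / 2"
    unfolding lnS lnN by (simp add: field_simps)
  finally have lnc: "real nu * ln c
      = real nu / 2 * (- lam * ln (1 + s') - lam * ln (1 - y) - ln (1 + lam * s) - ln (1 - lam * y'))"
    by simp
  also have "\<dots> \<le> real nu / 2 * (lam * t\<^sup>2 / (1 - t) + lam * t\<^sup>2 + (lam * t)\<^sup>2 + (lam * t)\<^sup>2 / (1 - lam * t))"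
    using s lam by (intro mult_left_mono log_det_bound) auto
  also have "\<dots> \<le> lam * eps + ln del" using budget del(2) by linarith
  also have "\<dots> = ln (exp (lam * eps) * del)" using del(1) by (simp add: ln_mult)
  finally have "ln (c ^ nu) \<le> ln (exp (lam * eps) * del)" using cpos by (simp add: ln_realpow)
  then have budget': "c ^ nu \<le> exp (lam * eps) * del"
    using cpos del(1) by (subst (asm) ln_le_cancel_iff) auto
  let ?P = "density lborel (\<lambda>x. ennreal (gaussian_density R x))"
  let ?Q = "density lborel (\<lambda>x. ennreal (gaussian_density S x))"
  let ?r = "\<lambda>x. gaussian_density R x / gaussian_density S x"
  have gA: "gauss (matrix_inv (transpose A ** A)) = ?P"
    using R by (rule gauss_eq_density)
  \<comment> \<open>\<open>S\<close> was built from the form of \<open>R\<close>; the row identity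
    \<open>i\<close> shows that it is a square factor for \<open>A'\<close>.\<close>
  have "norm (S *v x) = norm (A' *v x)" for x
    by (rule power2_eq_imp_eq) (auto simp: S R(2) i)
  then have gA': "gauss (matrix_inv (transpose A' ** A')) = ?Q"
    using nz(1) by (intro gauss_eq_density)
  have PQ: "?P = density ?Q ?r"
  proof -
    have "density ?Q ?r = density lborel (\<lambda>x. ennreal (gaussian_density S x) * ennreal (?r x))"
      by (rule density_density_eq) measurable
    also have "(\<lambda>x. ennreal (gaussian_density S x) * ennreal (?r x)) = (\<lambda>x. ennreal (gaussian_density R x))"
      using gaussian_density_pos[OF nz(1)] gaussian_density_pos[OF R(1)]
      by (simp add: fun_eq_iff less_imp_le less_imp_neq[symmetric] flip: ennreal_mult)
    finally show ?thesis by simp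
  qed
  have moment: "(\<integral>\<^sup>+x. ennreal (?r x powr lam) \<partial>?P) = ennreal c"
    unfolding c_def using R(1) nz by (intro gaussian_moment) (auto simp: N S)
  show ?thesis
    unfolding gA gA'
  proof (rule product_privacy)
    show "prob_space ?Q" "prob_space ?P"
      using R(1) nz(1) by (auto intro: prob_space_gaussian)
    show "?r \<in> borel_measurable ?Q" by simp
    show "?r x > 0" for x using R(1) nz(1) by (simp add: gaussian_density_pos)
    show "(\<integral>\<^sup>+x. ennreal (?r x powr lam) \<partial>?P) \<le> ennreal c" by (simp only: moment order_refl)
    show "T \<in> sets (PiM {..<nu} (\<lambda>_. ?P))" using T by (simp cong: sets_PiM_cong)
  qed (use PQ cpos del(1) lam(1) budget' in auto)
qed

section \<open>Transfer to the inverse-Wishart law\<close>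

lemma sets_gauss: "sets (gauss V) = sets borel"
  by (simp add: gauss_def)

lemma inv_wishart_eq_distr:
  fixes Psi :: "real^'d^'d"
  shows "inv_wishart Psi nu = distr (PiM {..<nu} (\<lambda>_. gauss (matrix_inv Psi))) borel
    (\<lambda>g. matrix_inv (\<Sum>i<nu. outer (g i)))"
    and "(\<lambda>g :: nat \<Rightarrow> real^'d. matrix_inv (\<Sum>i<nu. outer (g i)))
      \<in> PiM {..<nu} (\<lambda>_. borel) \<rightarrow>\<^sub>M borel"
proof -
  note [measurable] = measurable_outer measurable_matrix_inv
  have *: "(\<lambda>g :: nat \<Rightarrow> real^'d. \<Sum>i<nu. outer (g i)) \<in> PiM {..<nu} (\<lambda>_. borel) \<rightarrow>\<^sub>M borel"
    by measurable
  have "sets (PiM {..<nu} (\<lambda>_. gauss V)) = sets (PiM {..<nu} (\<lambda>_. borel))" for V :: "real^'d^'d"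
    by (intro sets_PiM_cong) (auto simp: sets_gauss)
  then have "(\<lambda>g. \<Sum>i<nu. outer (g i)) \<in> PiM {..<nu} (\<lambda>_. gauss (matrix_inv Psi)) \<rightarrow>\<^sub>M borel"
    using * by (simp cong: measurable_cong_sets)
  then show "inv_wishart Psi nu = distr (PiM {..<nu} (\<lambda>_. gauss (matrix_inv Psi))) borel
    (\<lambda>g. matrix_inv (\<Sum>i<nu. outer (g i)))"
    unfolding inv_wishart_def wishart_def
    by (subst distr_distr) (auto simp: comp_def measurable_matrix_inv)
  show "(\<lambda>g :: nat \<Rightarrow> real^'d. matrix_inv (\<Sum>i<nu. outer (g i)))
      \<in> PiM {..<nu} (\<lambda>_. borel) \<rightarrow>\<^sub>M borel"
    by (rule measurable_compose[OF * measurable_matrix_inv])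
qed

text \<open>The map from samples to output does not depend on \<open>Psi\<close>, so an output event
  has the same preimage for both inputs; this is the post-processing step.\<close>

lemma measure_inv_wishart:
  fixes Psi :: "real^'d^'d"
  assumes "X \<in> sets borel"
  shows "measure (inv_wishart Psi nu) X = measure (PiM {..<nu} (\<lambda>_. gauss (matrix_inv Psi)))
    ((\<lambda>g. matrix_inv (\<Sum>i<nu. outer (g i))) -` X \<inter> space (PiM {..<nu} (\<lambda>_. borel)))"
proof -
  let ?f = "\<lambda>g :: nat \<Rightarrow> real^'d. matrix_inv (\<Sum>i<nu. outer (g i))"
  have sets: "sets (PiM {..<nu} (\<lambda>_. gauss (matrix_inv Psi))) = sets (PiM {..<nu} (\<lambda>_. borel))"
    by (intro sets_PiM_cong) (auto simp: sets_gauss)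
  have "?f \<in> PiM {..<nu} (\<lambda>_. gauss (matrix_inv Psi)) \<rightarrow>\<^sub>M borel"
    using inv_wishart_eq_distr(2)[where 'd = 'd] sets by (simp cong: measurable_cong_sets)
  then show ?thesis
    using assms sets_eq_imp_space_eq[OF sets]
    by (simp add: inv_wishart_eq_distr(1) measure_distr)
qed

theorem theoremB4:
  fixes eps del B w :: real and nu :: nat
  assumes "eps > 0" and "0 < del" and "del < exp (-1)" and "B > 0"
    and "nu \<ge> CARD('d)"
    and "w > 0"
    and "w\<^sup>2 = B\<^sup>2 / (eps * (1 - eps / (2 * ln (4 / del))))
                 * (2 * sqrt (2 * real nu * ln (4 / del)) + 2 * ln (4 / del))"
  shows "differentially_private
           {A :: real ^ 'd ^ 'n. (\<forall>i. norm (A $ i) \<le> B) \<and> sigma_min A \<ge> w}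
           (\<lambda>A. inv_wishart (transpose A ** A) nu) eps del"
proof -
  define L where "L = ln (4 / del)"
  define t where "t = B\<^sup>2 / w\<^sup>2"
  define H where "H = 2 * sqrt (2 * real nu * L) + 2 * L"
  define c where "c = 1 - eps / (2 * L)"
  have "exp (-1) < (1 :: real)" by simp
  then have "del < 1" using assms(3) by linarith
  then have L: "L > 0" using assms(2) by (simp add: L_def)
  \<comment> \<open>The tail bound asks for \<open>exp (- L) \<le> del\<close>; the 4 inside the
    logarithm leaves room.\<close>
  have Ldel: "L \<ge> - ln del" using assms(2) by (simp add: L_def ln_div)
  have nu: "nu > 0" using assms(5) zero_less_card_finite[where 'a = 'd] by linarith
  have H: "H > 0" using L by (simp add: H_def add_nonneg_pos)
  have w2: "w\<^sup>2 = B\<^sup>2 / (eps * c) * H" using assms(7) by (simp add: c_def H_def L_def)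
  \<comment> \<open>The sign is read off from \<open>w^2 > 0\<close>. The case \<open>c = 0\<close>
    is included, as division by zero would make the right-hand side 0.\<close>
  have "c > 0"
  proof (rule ccontr)
    assume "\<not> c > 0"
    then have "eps * c \<le> 0" using assms(1) by (simp add: mult_le_0_iff)
    then have "B\<^sup>2 / (eps * c) * H \<le> 0"
      using H by (simp add: mult_le_0_iff divide_le_0_iff)
    then show False unfolding w2[symmetric] using assms(6) by simp
  qed
  then have epsL: "eps < 2 * L" using L by (simp add: c_def field_simps)
  have t: "t > 0" using assms(4,6) by (simp add: t_def)
  \<comment> \<open>The equation for \<open>w\<close>, solved for the sensitivity
    \<open>t\<close>.\<close>
  have "t * H = eps * c"
    using w2 \<open>c > 0\<close> assms(1,4,6) H by (simp add: t_def field_simps)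
  then obtain lam where lam: "lam > 0" "lam * t < 1" "t < 1"
    "real nu / 2 * (lam * t\<^sup>2 / (1 - t) + lam * t\<^sup>2 + (lam * t)\<^sup>2 + (lam * t)\<^sup>2 / (1 - lam * t))
      \<le> lam * eps - L"
    using privacy_budget[OF assms(1) L nu t epsL] unfolding H_def c_def by blast
  show ?thesis
    unfolding differentially_private_def
  proof (intro ballI impI)
    fix A A' :: "real^'d^'n" and X
    assume A: "A \<in> {A. (\<forall>i. norm (A $ i) \<le> B) \<and> sigma_min A \<ge> w}"
      and A': "A' \<in> {A. (\<forall>i. norm (A $ i) \<le> B) \<and> sigma_min A \<ge> w}"
      and nb: "neighbors A A'" and "X \<in> sets (inv_wishart (transpose A ** A) nu)"
    then have X: "X \<in> sets borel" by (simp add: inv_wishart_def)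
    show "measure (inv_wishart (transpose A ** A) nu) X
        \<le> exp eps * measure (inv_wishart (transpose A' ** A') nu) X + del"
      unfolding measure_inv_wishart[OF X]
      using A A' nb assms(2,6) Ldel lam t_def
      by (intro gauss_product_privacy[of w A B A' del L t lam nu eps]
          measurable_sets[OF inv_wishart_eq_distr(2) X]) auto
  qed
qed

end
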